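(* Let $\tau\in(0,\infty)$, let $\mu_1,\mu_2$ be non-negative Borel measures on $\mathbb{R}^+=[0,\infty)$ with $$M:=\mu_1([0,\tau])+\mu_2([0,\infty))\in(0,\infty),$$ let $f\in C(\mathbb{R}^+;(0,\infty))$ be locally Lipschitz continuous, and suppose there exists $\phi\in\mathcal{S}$ such that $f(x)\sim\phi(x)$ as $x\to\infty$. Let $\psi\in C([-\tau,0];(0,\infty))$. Put $F(x)=\int_1^x \frac{du}{f(u)}$ for $x>0$, and suppose moreover that $$\limsup_{x\to\infty}\frac{f(x)F(x)}{x}=:L<\infty.$$ Then the unique continuous solution $x$ of $$x'(t)=\int_{[0,\tau]}\mu_1(ds)f(x(t-s))+\int_{[0,t]}\mu_2(ds)f(x(t-s)),\quad t>0;\qquad x(t)=\psi(t),\ t\in[-\tau,0],$$ obeys $$\lim_{t\to\infty}x(t)=\infty,\qquad \lim_{t\to\infty}\frac{F(x(t))}{Mt}=1,\qquad\text{and}\qquad \lim_{t\to\infty}\frac{x(t)}{F^{-1}(Mt)}=1.$$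
   Context: $\mathcal{S}$ is the class of functions $\phi\in C^1((0,\infty);(0,\infty))\cap C(\mathbb{R}^+;(0,\infty))$ with $\phi'(x)>0$ for all $x>0$ and $\lim_{x\to\infty}\phi'(x)=0$. The notation $f(x)\sim\phi(x)$ as $x\to\infty$ means $\lim_{x\to\infty}f(x)/\phi(x)=1$. $F$ is strictly increasing; $F^{-1}$ is its inverse function. A solution is a continuous function on $[-\tau,\infty)$, locally absolutely continuous on $[0,\infty)$, equal to $\psi$ on $[-\tau,0]$ and satisfying the differential equation for almost every $t>0$. *)

theory Defs
  imports "HOL-Analysis.Analysis"
begin

definition classS :: "(real \<Rightarrow> real) set" where
  "classS = {\<phi>. \<phi> C1_differentiable_on {0<..} \<and> continuous_on {0..} \<phi> \<and> (\<forall>x\<ge>0. 0 < \<phi> x)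
     \<and> (\<forall>x>0. 0 < deriv \<phi> x) \<and> (deriv \<phi> \<longlongrightarrow> 0) at_top}"

text \<open>Absolute continuity of a function on \<open>{a..b}\<close>. Finite families of non-overlapping
  compact intervals are encoded as divisions of their union; the end points of a member \<open>K\<close>
  are \<open>Inf K\<close> and \<open>Sup K\<close>. The library constant \<open>absolutely_continuous\<close> is about measures.\<close>

definition abs_continuous_on_interval :: "real \<Rightarrow> real \<Rightarrow> (real \<Rightarrow> real) \<Rightarrow> bool" where
  "abs_continuous_on_interval a b g \<longleftrightarrow>
     (\<forall>\<epsilon>>0. \<exists>\<delta>>0. \<forall>\<D> T. \<D> division_of T \<and> T \<subseteq> {a..b} \<and> (\<Sum>K\<in>\<D>. Sup K - Inf K) < \<delta> \<longrightarrow>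
        (\<Sum>K\<in>\<D>. \<bar>g (Sup K) - g (Inf K)\<bar>) < \<epsilon>)"

text \<open>Solutions are functions on \<open>[-\<tau>, \<infinity>)\<close>; values of \<open>x\<close> to the left of \<open>-\<tau>\<close> are
  never used. The condition \<open>0 \<le> x t\<close> expresses that \<open>f\<close> is only given on \<open>[0, \<infinity>)\<close>, so that
  \<open>f (x (t - s))\<close> has to be meaningful.\<close>

definition volterra_solution ::
  "real \<Rightarrow> real measure \<Rightarrow> real measure \<Rightarrow> (real \<Rightarrow> real) \<Rightarrow> (real \<Rightarrow> real) \<Rightarrow> (real \<Rightarrow> real) \<Rightarrow> bool"
where
  "volterra_solution \<tau> \<mu>1 \<mu>2 f \<psi> x \<longleftrightarrow>
     continuous_on {-\<tau>..} x \<and> (\<forall>t\<ge>-\<tau>. 0 \<le> x t) \<and>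
     (\<forall>b>0. abs_continuous_on_interval 0 b x) \<and>
     (\<forall>t\<in>{-\<tau>..0}. x t = \<psi> t) \<and>
     (AE t in lborel. 0 < t \<longrightarrow>
        (x has_real_derivative
          (LINT s:{0..\<tau>}|\<mu>1. f (x (t - s))) + (LINT s:{0..t}|\<mu>2. f (x (t - s)))) (at t))"

text \<open>\<open>F x\<close> is the oriented integral of \<open>1 / f\<close> from \<open>1\<close> to \<open>x\<close>, negative for \<open>x < 1\<close>.\<close>

definition F_of :: "(real \<Rightarrow> real) \<Rightarrow> real \<Rightarrow> real" where
  "F_of f x = (LBINT u=ereal 1..ereal x. 1 / f u)"

definition F_inv :: "(real \<Rightarrow> real) \<Rightarrow> real \<Rightarrow> real" where
  "F_inv f = the_inv_into {0<..} (F_of f)"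

end

theory Submission
  imports Defs
begin

text \<open>The integral operator \<open>picard\<close> has Lipschitz constant \<open>1/2\<close> for the norm weighted by
  \<open>exp (2 * K * M * t)\<close>, and the linear growth of \<open>f\<close> (from \<open>deriv \<phi> \<longlongrightarrow> 0\<close>) keeps the iterates in a
  bounded range on bounded intervals; this gives existence. A solution differs from its image under
  \<open>picard\<close> by an absolutely continuous function whose derivative vanishes almost everywhere, so it is
  a fixed point; this gives uniqueness.

  The solution increases to infinity. Monotonicity of \<open>\<phi>\<close> gives \<open>x' \<le> (1 + \<epsilon>) M \<phi>(x)\<close> eventually, since
  the part of the integrals that sees the early values of \<open>x\<close> has vanishing mass. Hence \<open>x\<close> grows by at most a
  multiple of \<open>\<phi>(x t)\<close> on a window of fixed length, and as \<open>deriv \<phi> \<longlongrightarrow> 0\<close> the delay in that window is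
  asymptotically invisible to \<open>\<phi>\<close>, which gives the matching lower bound. Therefore
  \<open>(F \<circ> x)' = x' / f(x) \<longlongrightarrow> M\<close>. Finally, if \<open>f F / x \<le> L\<close> then \<open>L * ln F - ln\<close> is nondecreasing, so
  \<open>\<bar>ln x - ln z\<bar> \<le> L * \<bar>ln (F x) - ln (F z)\<bar>\<close>, which is applied with \<open>F z = M t\<close>.\<close>

section \<open>Absolutely continuous functions\<close>

lemma abs_continuous_on_interval_lipschitz:
  assumes "L-lipschitz_on {a..b} g"
  shows "abs_continuous_on_interval a b g"
  unfolding abs_continuous_on_interval_def
proof (intro allI impI)
  fix e :: real assume e: "e > 0"
  have L: "L \<ge> 0" using assms lipschitz_on_nonneg by blast
  show "\<exists>\<delta>>0. \<forall>\<D> T. \<D> division_of T \<and> T \<subseteq> {a..b} \<and> (\<Sum>K\<in>\<D>. Sup K - Inf K) < \<delta> \<longrightarrow>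
        (\<Sum>K\<in>\<D>. \<bar>g (Sup K) - g (Inf K)\<bar>) < e"
  proof (intro exI[of _ "e / (L + 1)"] conjI allI impI)
    show "e / (L + 1) > 0" using e L by simp
    fix \<D> T assume *: "\<D> division_of T \<and> T \<subseteq> {a..b} \<and> (\<Sum>K\<in>\<D>. Sup K - Inf K) < e / (L + 1)"
    have "\<bar>g (Sup K) - g (Inf K)\<bar> \<le> L * (Sup K - Inf K) \<and> 0 \<le> Sup K - Inf K" if K: "K \<in> \<D>" for K
    proof -
      from * have "\<D> division_of T" by blast
      note d = division_ofD[OF this]
      obtain u v where uv: "K = {u..v}" "K \<noteq> {}" using d(3,4)[OF K] by auto
      have "K \<subseteq> {a..b}" using d(2)[OF K] * by blast
      then have "u \<in> {a..b}" "v \<in> {a..b}" "u \<le> v" using uv by auto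
      with lipschitz_onD[OF assms, of v u] show ?thesis using uv by (simp add: dist_real_def)
    qed
    then have "(\<Sum>K\<in>\<D>. \<bar>g (Sup K) - g (Inf K)\<bar>) \<le> (\<Sum>K\<in>\<D>. L * (Sup K - Inf K))"
      and nn: "0 \<le> (\<Sum>K\<in>\<D>. Sup K - Inf K)"
      by (auto intro!: sum_mono sum_nonneg)
    then have "(\<Sum>K\<in>\<D>. \<bar>g (Sup K) - g (Inf K)\<bar>) \<le> L * (\<Sum>K\<in>\<D>. Sup K - Inf K)"
      by (simp add: sum_distrib_left)
    also have "\<dots> \<le> L * (e / (L + 1))" using * L by (intro mult_left_mono) auto
    also have "\<dots> < e" using e L by (simp add: field_simps)
    finally show "(\<Sum>K\<in>\<D>. \<bar>g (Sup K) - g (Inf K)\<bar>) < e" .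
  qed
qed

lemma abs_continuous_on_interval_diff:
  assumes "abs_continuous_on_interval a b g" "abs_continuous_on_interval a b h"
  shows "abs_continuous_on_interval a b (\<lambda>t. g t - h t)"
  unfolding abs_continuous_on_interval_def
proof (intro allI impI)
  fix e :: real assume e: "e > 0"
  then have e2: "e / 2 > 0" by simp
  obtain d1 where d1: "d1 > 0" "\<And>\<D> T. \<D> division_of T \<Longrightarrow> T \<subseteq> {a..b} \<Longrightarrow> (\<Sum>K\<in>\<D>. Sup K - Inf K) < d1 \<Longrightarrow>
        (\<Sum>K\<in>\<D>. \<bar>g (Sup K) - g (Inf K)\<bar>) < e / 2"
    using assms(1) e2 unfolding abs_continuous_on_interval_def by meson
  obtain d2 where d2: "d2 > 0" "\<And>\<D> T. \<D> division_of T \<Longrightarrow> T \<subseteq> {a..b} \<Longrightarrow> (\<Sum>K\<in>\<D>. Sup K - Inf K) < d2 \<Longrightarrow>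
        (\<Sum>K\<in>\<D>. \<bar>h (Sup K) - h (Inf K)\<bar>) < e / 2"
    using assms(2) e2 unfolding abs_continuous_on_interval_def by meson
  show "\<exists>\<delta>>0. \<forall>\<D> T. \<D> division_of T \<and> T \<subseteq> {a..b} \<and> (\<Sum>K\<in>\<D>. Sup K - Inf K) < \<delta> \<longrightarrow>
        (\<Sum>K\<in>\<D>. \<bar>g (Sup K) - h (Sup K) - (g (Inf K) - h (Inf K))\<bar>) < e"
  proof (intro exI[of _ "min d1 d2"] conjI allI impI)
    fix \<D> T assume *: "\<D> division_of T \<and> T \<subseteq> {a..b} \<and> (\<Sum>K\<in>\<D>. Sup K - Inf K) < min d1 d2"
    have "(\<Sum>K\<in>\<D>. \<bar>g (Sup K) - h (Sup K) - (g (Inf K) - h (Inf K))\<bar>)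
      \<le> (\<Sum>K\<in>\<D>. \<bar>g (Sup K) - g (Inf K)\<bar> + \<bar>h (Sup K) - h (Inf K)\<bar>)"
      by (intro sum_mono) linarith
    also have "\<dots> < e" using d1(2)[of \<D> T] d2(2)[of \<D> T] * by (simp add: sum.distrib)
    finally show "(\<Sum>K\<in>\<D>. \<bar>g (Sup K) - h (Sup K) - (g (Inf K) - h (Inf K))\<bar>) < e" .
  qed (use d1 d2 in auto)
qed

lemma abs_continuous_on_interval_cong:
  assumes "\<And>t. t \<in> {a..b} \<Longrightarrow> g t = h t" "abs_continuous_on_interval a b h"
  shows "abs_continuous_on_interval a b g"
proof -
  \<comment> \<open>The difference vanishes on the interval, so it is absolutely continuous there;
    subtracting it from \<open>h\<close> leaves \<open>g\<close>.\<close>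
  have lip: "0-lipschitz_on {a..b} (\<lambda>t. h t - g t)"
    using assms(1) by (auto intro!: lipschitz_onI)
  have "abs_continuous_on_interval a b (\<lambda>t. h t - (h t - g t))"
    by (rule abs_continuous_on_interval_diff[OF assms(2) abs_continuous_on_interval_lipschitz[OF lip]])
  then show ?thesis by simp
qed

text \<open>The point \<open>t\<close> lies between \<open>u\<close> and \<open>v\<close>, so the
  errors on its two sides are at most \<open>e * (v - t)\<close> and \<open>e * (t - u)\<close> and
  add up to \<open>e * (v - u)\<close>. Only differentiability at \<open>t\<close> itself
  enters.\<close>

lemma straddle_increment_le:
  fixes g :: "real \<Rightarrow> real"
  assumes "(g has_real_derivative D) (at t)" "D \<le> K" "0 < e"
  shows "\<exists>r>0. \<forall>u v. u \<le> t \<and> t \<le> v \<and> u \<in> ball t r \<and> v \<in> ball t r \<longrightarrow> g v - g u \<le> (K + e) * (v - u)"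
proof -
  have "(g has_derivative (\<lambda>h. h * D)) (at t)"
    using assms(1) by (simp add: has_field_derivative_def mult_commute_abs)
  then obtain r where r: "r > 0" "\<And>y. norm (y - t) < r \<Longrightarrow> norm (g y - g t - (y - t) * D) \<le> e * norm (y - t)"
    using assms(3) unfolding has_derivative_at_alt by blast
  show ?thesis
  proof (intro exI[of _ r] conjI allI impI r(1))
    fix u v assume uv: "u \<le> t \<and> t \<le> v \<and> u \<in> ball t r \<and> v \<in> ball t r"
    have 1: "\<bar>g v - g t - (v - t) * D\<bar> \<le> e * (v - t)" "\<bar>g u - g t - (u - t) * D\<bar> \<le> e * (t - u)"
      using r(2)[of v] r(2)[of u] uv by (auto simp: dist_real_def abs_minus_commute)
    have "g v - g u \<le> (v - u) * D + e * (v - u)" using 1 by (auto simp: algebra_simps abs_le_iff)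
    also have "\<dots> \<le> (v - u) * K + e * (v - u)" using uv assms(2) by (intro add_right_mono mult_left_mono) auto
    finally show "g v - g u \<le> (K + e) * (v - u)" by (simp add: algebra_simps)
  qed
qed

text \<open>Members of a division meet in end points at most, so their lengths add up to the measure
  of the union. This controls the total length of intervals caught inside a small open set.\<close>

lemma sum_length_division_le_measure:
  assumes "\<D> division_of (\<Union>\<D>)" "\<Union>\<D> \<subseteq> U" "U \<in> lmeasurable"
  shows "(\<Sum>K\<in>\<D>. Sup K - Inf K) \<le> measure lebesgue (U :: real set)"
proof -
  have "(\<Sum>K\<in>\<D>. Sup K - Inf K) = (\<Sum>K\<in>\<D>. measure lebesgue K)"
  proof (rule sum.cong[OF refl])
    fix K assume "K \<in> \<D>"
    then obtain u v where "K = {u..v}" "K \<noteq> {}" using division_ofD(3,4)[OF assms(1)] by (metis interval_cbox)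
    then show "Sup K - Inf K = measure lebesgue K" by simp
  qed
  also have "\<dots> = measure lebesgue (\<Union>\<D>)"
    using content_division[OF assms(1)] by simp
  also have "\<dots> \<le> measure lebesgue U"
    using assms by (intro measure_mono_fmeasurable) (auto dest: lmeasurable_division fmeasurableD)
  finally show ?thesis .
qed

text \<open>Henstock's argument: the null set where the derivative bound fails is covered by an open set
  of small measure, and a fine tagged division splits the increment into straddle estimates and
  a remainder controlled by absolute continuity.\<close>

lemma abs_continuous_increment_le:
  assumes ab: "a \<le> b"
    and ac: "abs_continuous_on_interval a b g"
    and der: "AE t in lborel. a < t \<and> t < b \<longrightarrow> (\<exists>D\<le>K. (g has_real_derivative D) (at t))"
  shows "g b - g a \<le> K * (b - a)"
proof (rule field_le_epsilon)
  fix e0 :: real assume "0 < e0"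
  \<comment> \<open>The final error is \<open>e * (b - a)\<close> from the straddle estimates,
    \<open>e\<close> from the increments over the bad intervals and \<open>e\<close> from the length
    they occupy.\<close>
  define e where "e = e0 / (b - a + 2)"
  have e: "e > 0" using \<open>0 < e0\<close> ab by (simp add: e_def)
  obtain N0 where N0: "{t \<in> space lborel. \<not> (a < t \<and> t < b \<longrightarrow> (\<exists>D\<le>K. (g has_real_derivative D) (at t)))} \<subseteq> N0"
    "emeasure lborel N0 = 0" "N0 \<in> sets lborel"
    using der by (auto elim: AE_E)
  \<comment> \<open>The end points join the null set because the derivative bound is assumed in the
    open interval only.\<close>
  define N where "N = N0 \<union> {a, b}"
  have "N0 \<in> null_sets lborel" using N0 by auto
  then have Nnull: "N \<in> null_sets lborel" unfolding N_def
    by (rule null_sets.Un) (auto intro: finite_imp_null_set_lborel)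
  have good: "\<exists>D\<le>K. (g has_real_derivative D) (at t)" if "t \<in> {a..b}" "t \<notin> N" for t
    using that N0(1) by (force simp: N_def)
  obtain d where d: "d > 0" "\<And>\<D> T. \<D> division_of T \<Longrightarrow> T \<subseteq> {a..b} \<Longrightarrow> (\<Sum>K\<in>\<D>. Sup K - Inf K) < d \<Longrightarrow>
        (\<Sum>K\<in>\<D>. \<bar>g (Sup K) - g (Inf K)\<bar>) < e"
    using ac e unfolding abs_continuous_on_interval_def by meson
  \<comment> \<open>The first bound serves absolute continuity on the bad intervals; the second
    makes their total length negligible when multiplied by \<open>K + e\<close>.\<close>
  define d' where "d' = min d (e / (\<bar>K + e\<bar> + 1))"
  have d': "d' > 0" "d' \<le> d" using d(1) e by (auto simp: d'_def)
  have d'_le: "\<bar>K + e\<bar> * d' \<le> e"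
  proof -
    have "\<bar>K + e\<bar> * d' \<le> (\<bar>K + e\<bar> + 1) * (e / (\<bar>K + e\<bar> + 1))"
      using d' by (intro mult_mono) (auto simp: d'_def)
    then show ?thesis by simp
  qed
  have "N \<in> null_sets lebesgue" using Nnull by (simp add: null_sets_completionI)
  then have "N \<in> sets lebesgue" "emeasure lebesgue N = 0" by auto
  \<comment> \<open>Every interval tagged in \<open>N\<close> will lie in \<open>U\<close>, so these
    intervals have total length below \<open>d'\<close>.\<close>
  then obtain U where U: "open U" "N \<subseteq> U" "U - N \<in> lmeasurable" "emeasure lebesgue (U - N) < ennreal d'"
    using sets_lebesgue_outer_open[of N d'] d'(1) by blast
  have "N \<in> lmeasurable" using \<open>N \<in> sets lebesgue\<close> \<open>emeasure lebesgue N = 0\<close> by (intro fmeasurableI) auto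
  have UN: "U = (U - N) \<union> N" using U(2) by blast
  have Ulm: "U \<in> lmeasurable" using UN U(3) \<open>N \<in> lmeasurable\<close> fmeasurable.Un by metis
  have "emeasure lebesgue U \<le> emeasure lebesgue (U - N) + emeasure lebesgue N"
    using emeasure_subadditive[of "U - N" lebesgue N] UN U(3) \<open>N \<in> sets lebesgue\<close> fmeasurableD by metis
  then have "emeasure lebesgue U < ennreal d'" using U(4) \<open>emeasure lebesgue N = 0\<close> by simp
  then have mU: "measure lebesgue U < d'"
    using Ulm d'(1) by (simp add: emeasure_eq_measure2 ennreal_less_iff)
  have "\<exists>r>0. (t \<in> N \<longrightarrow> ball t r \<subseteq> U) \<and> (t \<in> {a..b} - N \<longrightarrow>
     (\<forall>u v. u \<le> t \<and> t \<le> v \<and> u \<in> ball t r \<and> v \<in> ball t r \<longrightarrow> g v - g u \<le> (K + e) * (v - u)))" for t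
  proof (cases "t \<in> N")
    case True
    then show ?thesis using U(1,2) open_contains_ball by blast
  next
    case False
    show ?thesis
    proof (cases "t \<in> {a..b}")
      case True
      obtain D where "D \<le> K" "(g has_real_derivative D) (at t)" using good True False by blast
      from straddle_increment_le[OF this(2,1) e] show ?thesis using False by blast
    next
      assume "t \<notin> {a..b}"
      then show ?thesis using False by (intro exI[of _ 1]) auto
    qed
  qed
  then obtain r where r: "\<And>t. r t > 0" "\<And>t. t \<in> N \<Longrightarrow> ball t (r t) \<subseteq> U"
    "\<And>t u v. t \<in> {a..b} - N \<Longrightarrow> u \<le> t \<Longrightarrow> t \<le> v \<Longrightarrow> u \<in> ball t (r t) \<Longrightarrow> v \<in> ball t (r t) \<Longrightarrow>
        g v - g u \<le> (K + e) * (v - u)"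
    by metis
  have "gauge (\<lambda>t. ball t (r t))" using r(1) by (intro gaugeI) auto
  then obtain p where p: "p tagged_division_of {a..b}" "(\<lambda>t. ball t (r t)) fine p"
    using fine_division_exists_real by blast
  define q where "q = {z \<in> p. fst z \<in> N}"
  have fin: "finite p" using p(1) by auto
  note td = tagged_division_ofD[OF p(1)]
  have pe: "\<exists>u v. k = {u..v} \<and> u \<le> t \<and> t \<le> v \<and> u \<in> {a..b} \<and> v \<in> {a..b} \<and> u \<in> ball t (r t) \<and> v \<in> ball t (r t) \<and> t \<in> {a..b}"
    if tk: "(t, k) \<in> p" for t k
  proof -
    obtain u v where uv: "k = {u..v}" "t \<in> k" "k \<subseteq> {a..b}" using td(2-4)[OF tk] by auto
    moreover have "k \<subseteq> ball t (r t)" using p(2) tk by (auto simp: fine_def)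
    ultimately show ?thesis by (intro exI[of _ u] exI[of _ v]) (auto simp: subset_iff)
  qed
  have good_le: "(\<Sum>(t,k)\<in>p - q. g (Sup k) - g (Inf k)) \<le> (\<Sum>(t,k)\<in>p - q. (K + e) * (Sup k - Inf k))"
  proof (rule sum_mono, clarify)
    fix t k assume tk: "(t, k) \<in> p" "(t, k) \<notin> q"
    then have "t \<notin> N" by (auto simp: q_def)
    obtain u v where "k = {u..v}" "u \<le> t" "t \<le> v" "u \<in> ball t (r t)" "v \<in> ball t (r t)" "t \<in> {a..b}"
      using pe[OF tk(1)] by blast
    with r(3)[of t u v] \<open>t \<notin> N\<close> show "g (Sup k) - g (Inf k) \<le> (K + e) * (Sup k - Inf k)" by auto
  qed
  have q_part: "q tagged_division_of (\<Union>(snd ` q))"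
  proof (rule tagged_partial_division_of_Union_self)
    show "q tagged_partial_division_of {a..b}"
      using p(1) by (auto simp: q_def tagged_division_of_def intro: tagged_partial_division_subset[of p])
  qed
  note q_div = division_of_tagged_division[OF q_part]
  have q_ne: "k \<noteq> {}" if "k \<in> snd ` q" for k
    using that by (auto simp: q_def dest: td(2))
  \<comment> \<open>This passes from tagged intervals to the division that absolute continuity
    speaks of. The transfer asks for summands that vanish on degenerate intervals; the conditional
    takes care of the empty set, where \<open>Inf\<close> and \<open>Sup\<close> carry no
    meaning.\<close>
  have reindex: "(\<Sum>(t,k)\<in>q. h (Inf k) (Sup k)) = (\<Sum>k\<in>snd ` q. h (Inf k) (Sup k))"
    if "\<And>u. h u u = 0" for h :: "real \<Rightarrow> real \<Rightarrow> real"
  proof -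
    have "(\<Sum>(t,k)\<in>q. h (Inf k) (Sup k)) = (\<Sum>(t,k)\<in>q. if k = {} then 0 else h (Inf k) (Sup k))"
      using q_ne by (intro sum.cong) force+
    also have "\<dots> = (\<Sum>k\<in>snd ` q. if k = {} then 0 else h (Inf k) (Sup k))"
    proof (rule sum.over_tagged_division_lemma[OF q_part])
      fix u v :: real assume "box u v = {}"
      then have "v \<le> u" by (simp add: box_real)
      then show "(if cbox u v = {} then 0 else h (Inf (cbox u v)) (Sup (cbox u v))) = 0"
        using that by (cases "u = v") auto
    qed
    also have "\<dots> = (\<Sum>k\<in>snd ` q. h (Inf k) (Sup k))"
      using q_ne by (intro sum.cong) auto
    finally show ?thesis .
  qed
  have sub_ab: "\<Union>(snd ` q) \<subseteq> {a..b}" using td(3) by (fastforce simp: q_def)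
  have sub_U: "\<Union>(snd ` q) \<subseteq> U"
  proof
    fix y assume "y \<in> \<Union>(snd ` q)"
    then obtain t k where tk: "(t, k) \<in> p" "t \<in> N" "y \<in> k" by (auto simp: q_def)
    then show "y \<in> U" using p(2) r(2)[of t] by (auto simp: fine_def subset_iff)
  qed
  define S where "S = (\<Sum>(t,k)\<in>q. Sup k - Inf k)"
  have S_eq: "S = (\<Sum>k\<in>snd ` q. Sup k - Inf k)"
    unfolding S_def by (rule reindex[of "\<lambda>u v. v - u"]) simp
  have S: "S \<le> d'" "0 \<le> S"
  proof -
    show "S \<le> d'" using sum_length_division_le_measure[OF q_div sub_U Ulm] mU S_eq by linarith
    show "0 \<le> S" unfolding S_def using pe by (intro sum_nonneg) (fastforce simp: q_def)
  qed
  have "(\<Sum>(t,k)\<in>q. g (Sup k) - g (Inf k)) \<le> (\<Sum>(t,k)\<in>q. \<bar>g (Sup k) - g (Inf k)\<bar>)"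
    by (intro sum_mono) auto
  also have "\<dots> = (\<Sum>k\<in>snd ` q. \<bar>g (Sup k) - g (Inf k)\<bar>)"
    by (rule reindex[of "\<lambda>u v. \<bar>g v - g u\<bar>"]) simp
  also have "\<dots> < e"
    using d(2)[OF q_div sub_ab] sum_length_division_le_measure[OF q_div sub_U Ulm] mU d'(2) by linarith
  finally have bad_le: "(\<Sum>(t,k)\<in>q. g (Sup k) - g (Inf k)) < e" .
  have "q \<subseteq> p" by (auto simp: q_def)
  note split = sum.subset_diff[OF this fin]
  have "b - a = (\<Sum>(t,k)\<in>p - q. Sup k - Inf k) + S"
    using additive_tagged_division_1[OF ab p(1), of "\<lambda>t. t"] split[of "\<lambda>(t,k). Sup k - Inf k"] by (simp add: S_def)
  then have "(\<Sum>(t,k)\<in>p - q. (K + e) * (Sup k - Inf k)) = (K + e) * (b - a - S)"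
    by (simp add: sum_distrib_left case_prod_unfold)
  \<comment> \<open>\<open>K + e\<close> may be negative, and then replacing the length of the good
    intervals by \<open>b - a\<close> costs up to \<open>\<bar>K + e\<bar> * S\<close>.\<close>
  moreover have "(K + e) * (b - a - S) \<le> (K + e) * (b - a) + e"
  proof -
    have "- (K + e) * S \<le> \<bar>K + e\<bar> * S" using S by (intro mult_right_mono) auto
    also have "\<dots> \<le> \<bar>K + e\<bar> * d'" using S by (intro mult_left_mono) auto
    also have "\<dots> \<le> e" by (rule d'_le)
    finally show ?thesis by (simp add: algebra_simps)
  qed
  moreover have "g b - g a = (\<Sum>(t,k)\<in>p - q. g (Sup k) - g (Inf k)) + (\<Sum>(t,k)\<in>q. g (Sup k) - g (Inf k))"
    using additive_tagged_division_1[OF ab p(1), of g] split[of "\<lambda>(t,k). g (Sup k) - g (Inf k)"] by simp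
  ultimately have "g b - g a \<le> (K + e) * (b - a) + e + e" using good_le bad_le by linarith
  moreover have "e * (b - a + 2) = e0" using ab by (simp add: e_def)
  ultimately show "g b - g a \<le> K * (b - a) + e0" by (simp add: algebra_simps)
qed

section \<open>Convolution with a finite measure on the half-line\<close>

text \<open>The measures live on the whole line and are carried by the half-line, so that Borel
  measurability and dominated convergence apply without restricted spaces.\<close>

locale causal_kernel = finite_measure N for N :: "real measure" +
  assumes sets_N [measurable_cong]: "sets N = sets borel"
    and AE_nonneg: "AE s in N. 0 \<le> s"
begin

lemma space_N [simp]: "space N = UNIV"
  using sets_eq_imp_space_eq[OF sets_N] by simp

text \<open>Both integrals of the equation have this form: \<open>c = \<tau>\<close> for \<open>\<mu>1\<close>, where the cut-off is void
  because \<open>\<mu>1\<close> is restricted to \<open>{0..\<tau>}\<close>, and \<open>c = 0\<close> for \<open>\<mu>2\<close>.\<close>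

definition conv :: "real \<Rightarrow> (real \<Rightarrow> real) \<Rightarrow> real \<Rightarrow> real" where
  "conv c h t = (LINT s|N. indicator {..t + c} s * h (t - s))"

lemma integrable_indicator_borel: "A \<in> sets borel \<Longrightarrow> integrable N (indicator A :: real \<Rightarrow> real)"
  by (auto simp: integrable_indicator_iff sets_N emeasure_eq_measure)

text \<open>For \<open>0 \<le> s \<le> t + c\<close> the argument \<open>t - s\<close> lies in
  \<open>{-c..t}\<close>; beyond the cut-off the integrand is 0, which the sign of \<open>B\<close>
  covers.\<close>

lemma AE_conv_bound:
  fixes h :: "real \<Rightarrow> real"
  assumes "\<And>v. v \<in> {-c..t} \<Longrightarrow> \<bar>h v\<bar> \<le> B" "0 \<le> B"
  shows "AE s in N. \<bar>indicator {..t + c} s * h (t - s)\<bar> \<le> B"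
  using AE_nonneg
proof eventually_elim
  case (elim s)
  then show ?case using assms(1)[of "t - s"] assms(2) by (cases "s \<le> t + c") auto
qed

lemma continuous_bounded_Icc:
  fixes h :: "real \<Rightarrow> real"
  assumes "continuous_on UNIV h"
  shows "\<exists>B\<ge>0. \<forall>v\<in>{a..b}. \<bar>h v\<bar> \<le> B"
proof -
  have "bounded (h ` {a..b})"
    using assms by (intro compact_imp_bounded compact_continuous_image) (auto intro: continuous_on_subset)
  then obtain B where "0 < B" "\<forall>y\<in>h ` {a..b}. norm y \<le> B" by (auto simp: bounded_pos)
  then show ?thesis by (intro exI[of _ B]) auto
qed

lemma integrable_conv:
  fixes h :: "real \<Rightarrow> real"
  assumes "continuous_on UNIV h"
  shows "integrable N (\<lambda>s. indicator {..t + c} s * h (t - s))"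
proof -
  have [measurable]: "h \<in> borel_measurable borel" using assms by (rule borel_measurable_continuous_onI)
  obtain B where B: "0 \<le> B" "\<And>v. v \<in> {-c..t} \<Longrightarrow> \<bar>h v\<bar> \<le> B"
    using continuous_bounded_Icc[OF assms, of "-c" t] by blast
  show ?thesis
    using AE_conv_bound[of c t h B] B by (intro integrable_const_bound[of _ B]) auto
qed

lemma conv_diff:
  assumes "continuous_on UNIV h" "continuous_on UNIV k"
  shows "conv c (\<lambda>v. h v - k v) t = conv c h t - conv c k t"
  unfolding conv_def
  by (subst Bochner_Integration.integral_diff[symmetric, OF integrable_conv[OF assms(1)] integrable_conv[OF assms(2)]])
    (simp add: right_diff_distrib)

lemma abs_conv_le:
  assumes "continuous_on UNIV h" "\<And>v. v \<in> {-c..t} \<Longrightarrow> \<bar>h v\<bar> \<le> B" "0 \<le> B"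
  shows "\<bar>conv c h t\<bar> \<le> B * measure N UNIV"
proof -
  have "\<bar>conv c h t\<bar> \<le> (LINT s|N. \<bar>indicator {..t + c} s * h (t - s)\<bar>)"
    unfolding conv_def by (rule integral_abs_bound)
  also have "\<dots> \<le> (LINT s|N. B)"
    using assms AE_conv_bound[of c t h B] by (intro integral_mono_AE integrable_abs integrable_conv) auto
  finally show ?thesis by (simp add: mult.commute)
qed

lemma conv_nonneg:
  assumes "\<And>v. 0 \<le> h v"
  shows "0 \<le> conv c h t"
  unfolding conv_def using assms by (intro integral_nonneg_AE) auto

text \<open>Delays up to \<open>t - T\<close> see \<open>h\<close> on \<open>{T..t}\<close>; longer
  ones see the early values, and their mass tends to 0 as \<open>t\<close> grows.\<close>

lemma conv_le_split:
  assumes "continuous_on UNIV h" "\<And>v. v \<in> {T..t} \<Longrightarrow> h v \<le> S" "\<And>v. v \<in> {-c..T} \<Longrightarrow> h v \<le> C" "0 \<le> S" "0 \<le> C"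
  shows "conv c h t \<le> S * measure N UNIV + C * measure N {t - T<..}"
proof -
  have "conv c h t \<le> (LINT s|N. S + C * indicator {t - T<..} s)"
    unfolding conv_def
  proof (rule integral_mono_AE)
    show "AE s in N. indicator {..t + c} s * h (t - s) \<le> S + C * indicator {t - T<..} s"
      using AE_nonneg
    proof eventually_elim
      case (elim s)
      show ?case
      proof (cases "s \<le> t + c")
        case True
        then show ?thesis using assms(2)[of "t - s"] assms(3)[of "t - s"] assms(4,5) elim
          by (cases "t - T < s") (auto simp: indicator_def)
      qed (use assms in \<open>auto simp: indicator_def\<close>)
    qed
  qed (use assms in \<open>auto intro!: integrable_conv simp: integrable_indicator_borel\<close>)
  also have "\<dots> = S * measure N UNIV + C * measure N {t - T<..}"
    by (subst Bochner_Integration.integral_add) (auto simp: mult.commute integrable_indicator_borel)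
  finally show ?thesis .
qed

text \<open>Only the delays up to \<open>T\<close> are kept; \<open>T \<le> t + c\<close> puts all
  of them before the cut-off.\<close>

lemma conv_ge:
  assumes "continuous_on UNIV h" "\<And>v. 0 \<le> h v" "\<And>v. v \<in> {t - T..t} \<Longrightarrow> S \<le> h v" "0 \<le> S" "T \<le> t + c"
  shows "S * measure N {..T} \<le> conv c h t"
proof -
  have "S * measure N {..T} = (LINT s|N. S * indicator {..T} s)" by (auto simp: mult.commute)
  also have "\<dots> \<le> conv c h t"
    unfolding conv_def
  proof (rule integral_mono_AE)
    show "AE s in N. S * indicator {..T} s \<le> indicator {..t + c} s * h (t - s)"
      using AE_nonneg
    proof eventually_elim
      case (elim s)
      then show ?case using assms(2)[of "t - s"] assms(3)[of "t - s"] assms(4,5) by (auto simp: indicator_def)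
    qed
  qed (use assms in \<open>auto intro!: integrable_conv simp: integrable_indicator_borel\<close>)
  finally show ?thesis .
qed

lemma borel_measurable_conv:
  assumes "continuous_on UNIV h"
  shows "conv c h \<in> borel_measurable borel"
proof -
  have [measurable]: "h \<in> borel_measurable borel" using assms by (rule borel_measurable_continuous_onI)
  \<comment> \<open>Written as a conditional on \<open>s \<le> t + c\<close>, the integrand is
    visibly measurable jointly in \<open>t\<close> and \<open>s\<close>.\<close>
  have "conv c h = (\<lambda>t. LINT s|N. (if s \<le> t + c then h (t - s) else 0))"
    unfolding conv_def by (intro ext Bochner_Integration.integral_cong) (auto simp: indicator_def)
  also have "\<dots> \<in> borel_measurable borel"
    by measurable
  finally show ?thesis .
qed

text \<open>For fixed \<open>s\<close> the integrand can jump only when the cut-off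
  \<open>t + c\<close> passes \<open>s\<close>. If that point has mass 0, the integrand converges
  almost everywhere and dominated convergence applies.\<close>

lemma isCont_conv:
  assumes h: "continuous_on UNIV h" and atom: "measure N {t + c} = 0"
  shows "isCont (conv c h) t"
proof -
  have [measurable]: "h \<in> borel_measurable borel" using h by (rule borel_measurable_continuous_onI)
  let ?I = "{t - 1<..<t + 1}"
  obtain B where B: "0 \<le> B" "\<And>v. v \<in> {-c..t + 1} \<Longrightarrow> \<bar>h v\<bar> \<le> B"
    using continuous_bounded_Icc[OF h, of "-c" "t + 1"] by blast
  have "{t + c} \<in> null_sets N" using atom by (auto simp: emeasure_eq_measure sets_N)
  then have AE_ne: "AE s in N. s \<noteq> t + c" using AE_not_in by fastforce
  \<comment> \<open>The bounded neighbourhood lets a single constant \<open>B\<close> dominate along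
    the whole sequence.\<close>
  have "(conv c h \<longlongrightarrow> conv c h t) (at t within ?I)"
    unfolding tendsto_at_iff_sequentially
  proof (intro allI impI)
    fix X :: "nat \<Rightarrow> real" assume X: "\<forall>i. X i \<in> ?I - {t}" "X \<longlonglongrightarrow> t"
    show "(conv c h \<circ> X) \<longlonglongrightarrow> conv c h t"
      unfolding conv_def comp_def
    proof (rule integral_dominated_convergence[where w="\<lambda>_. B"])
      show "AE s in N. (\<lambda>i. indicator {..X i + c} s * h (X i - s)) \<longlonglongrightarrow> indicator {..t + c} s * h (t - s)"
        using AE_ne
      proof eventually_elim
        case (elim s)
        have "(\<lambda>i. h (X i - s)) \<longlonglongrightarrow> h (t - s)"
          using h X(2) by (intro continuous_on_tendsto_compose[of UNIV h]) (auto intro!: tendsto_intros)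
        moreover have "eventually (\<lambda>i. (indicator {..X i + c} s :: real) = indicator {..t + c} s) sequentially"
        proof (cases "s < t + c")
          case True
          then have "eventually (\<lambda>i. X i > s - c) sequentially"
            using X(2) by (intro order_tendstoD(1)) auto
          then show ?thesis by eventually_elim (use True in \<open>auto simp: indicator_def\<close>)
        next
          case False
          then have "eventually (\<lambda>i. X i < s - c) sequentially"
            using X(2) elim by (intro order_tendstoD(2)) auto
          then show ?thesis by eventually_elim (use False elim in \<open>auto simp: indicator_def\<close>)
        qed
        ultimately show ?case
          by (intro tendsto_mult[OF tendsto_eventually])
      qed
      fix i
      have "X i < t + 1" using X(1) by auto
      then have "\<And>v. v \<in> {-c..X i} \<Longrightarrow> \<bar>h v\<bar> \<le> B" using B(2) by auto
      from AE_conv_bound[OF this B(1)] show "AE s in N. norm (indicator {..X i + c} s * h (X i - s)) \<le> B" by simp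
    qed auto
  qed
  then show ?thesis by (simp add: isCont_def at_within_open[of t ?I])
qed

text \<open>Continuity from above along the integers, where the finite mass enters; monotonicity
  then covers real \<open>T\<close>.\<close>

lemma tail_small:
  assumes "0 < e"
  shows "\<exists>T0\<ge>0. \<forall>T\<ge>T0. measure N {T<..} < e"
proof -
  have "(\<lambda>n. measure N {real n<..}) \<longlonglongrightarrow> measure N (\<Inter>n. {real n<..})"
    by (rule finite_Lim_measure_decseq) (auto simp: decseq_def sets_N)
  moreover have "(\<Inter>n. {real n<..}) = {}"
    using reals_Archimedean2[where 'a=real] by (auto simp: not_less) (meson less_asym)
  ultimately have "(\<lambda>n. measure N {real n<..}) \<longlonglongrightarrow> 0" by simp
  then have "eventually (\<lambda>n. measure N {real n<..} < e) sequentially" using assms by (rule order_tendstoD)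
  then obtain n where n: "measure N {real n<..} < e" by (auto simp: eventually_sequentially)
  have "measure N {T<..} < e" if "T \<ge> real n" for T
  proof -
    have "measure N {T<..} \<le> measure N {real n<..}" using that by (intro finite_measure_mono) (auto simp: sets_N)
    then show ?thesis using n by linarith
  qed
  then show ?thesis by (intro exI[of _ "real n"]) auto
qed

lemma measure_atMost_tail: "measure N {..T} = measure N UNIV - measure N {T<..}"
proof -
  have "UNIV - {T<..} = {..T}" by auto
  then show ?thesis using finite_measure_compl[of "{T<..}"] by (simp add: sets_N)
qed

end

section \<open>The fixed point equation\<close>

lemma continuous_on_UNIV_atMost:
  fixes g :: "real \<Rightarrow> real"
  assumes "\<And>b. continuous_on {..b} g"
  shows "continuous_on UNIV g"
proof (rule continuous_at_imp_continuous_on, safe)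
  fix t :: real
  have "continuous_on {..<t + 1} g" using assms[of "t + 1"] by (rule continuous_on_subset) auto
  then show "isCont g t" by (simp add: continuous_on_eq_continuous_at)
qed

lemma has_integral_exp:
  assumes "0 \<le> (t::real)"
  shows "((\<lambda>u. a * exp (a * u)) has_integral exp (a * t) - 1) {0..t}"
proof -
  have "((\<lambda>u. a * exp (a * u)) has_integral exp (a * t) - exp (a * 0)) {0..t}"
    using assms by (intro fundamental_theorem_of_calculus)
      (auto intro!: derivative_eq_intros simp: has_real_derivative_iff_has_vector_derivative[symmetric])
  then show ?thesis by simp
qed

text \<open>Here \<open>f\<close> and \<open>\<psi>\<close> are already extended to the line,
  \<open>\<psi>\<close> by constants on both sides. Linear growth is all that existence uses of the
  comparison with the class of \<phi>.\<close>

locale delay_volterra = K1: causal_kernel N1 + K2: causal_kernel N2 for N1 N2 :: "real measure" +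
  fixes \<tau> M :: real and f \<psi> :: "real \<Rightarrow> real"
  assumes tau: "0 < \<tau>" and M_pos: "0 < M"
    and M_eq: "measure N1 UNIV + measure N2 UNIV = M"
    and f_cont: "continuous_on UNIV f" and f_pos: "\<And>x. 0 < f x"
    and f_lip: "\<And>B. \<exists>K. K-lipschitz_on {0..B} f"
    and f_growth: "\<exists>C. \<forall>x\<ge>0. f x \<le> C * (1 + x)"
    and psi_cont: "continuous_on UNIV \<psi>" and psi_pos: "\<And>t. 0 < \<psi> t"
    and psi_left: "\<And>t. t < -\<tau> \<Longrightarrow> \<psi> t = \<psi> (-\<tau>)"
    and psi_right: "\<And>t. 0 < t \<Longrightarrow> \<psi> t = \<psi> 0"
begin

definition rhs :: "(real \<Rightarrow> real) \<Rightarrow> real \<Rightarrow> real" where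
  "rhs h t = K1.conv \<tau> h t + K2.conv 0 h t"

text \<open>The times at which a cut-off meets a point mass, hence the only ones where
  \<open>rhs\<close> of a continuous function can jump.\<close>

definition atoms :: "real set" where
  "atoms = {t. measure N1 {t + \<tau>} \<noteq> 0} \<union> {t. measure N2 {t} \<noteq> 0}"

text \<open>For \<open>t \<le> 0\<close> the integral vanishes and the initial function remains; for
  \<open>t > 0\<close> the first term is the constant \<open>\<psi> 0\<close>. One formula thus
  covers both ranges.\<close>

definition picard :: "(real \<Rightarrow> real) \<Rightarrow> real \<Rightarrow> real" where
  "picard x t = \<psi> t + integral {0..t} (rhs (\<lambda>v. f (x v)))"

lemma countable_atoms: "countable atoms"
proof -
  have "{t. measure N1 {t + \<tau>} \<noteq> 0} = (\<lambda>s. s - \<tau>) ` {s. measure N1 {s} \<noteq> 0}"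
  proof (intro set_eqI iffI)
    fix t assume "t \<in> {t. measure N1 {t + \<tau>} \<noteq> 0}"
    then show "t \<in> (\<lambda>s. s - \<tau>) ` {s. measure N1 {s} \<noteq> 0}" by (intro image_eqI[of _ _ "t + \<tau>"]) auto
  qed auto
  then show ?thesis
    using K1.countable_support K2.countable_support by (simp add: atoms_def)
qed

lemma rhs_diff:
  assumes "continuous_on UNIV h" "continuous_on UNIV k"
  shows "rhs (\<lambda>v. h v - k v) t = rhs h t - rhs k t"
  using K1.conv_diff[OF assms] K2.conv_diff[OF assms] by (simp add: rhs_def)

lemma abs_rhs_le:
  assumes "continuous_on UNIV h" "\<And>v. v \<le> t \<Longrightarrow> \<bar>h v\<bar> \<le> B" "0 \<le> B"
  shows "\<bar>rhs h t\<bar> \<le> B * M"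
proof -
  have "\<bar>K1.conv \<tau> h t\<bar> \<le> B * measure N1 UNIV" "\<bar>K2.conv 0 h t\<bar> \<le> B * measure N2 UNIV"
    using assms by (auto intro!: K1.abs_conv_le K2.abs_conv_le)
  then show ?thesis by (simp add: rhs_def M_eq[symmetric] algebra_simps)
qed

lemma rhs_nonneg: "(\<And>v. 0 \<le> h v) \<Longrightarrow> 0 \<le> rhs h t"
  unfolding rhs_def by (intro add_nonneg_nonneg K1.conv_nonneg K2.conv_nonneg)

lemma isCont_rhs: "continuous_on UNIV h \<Longrightarrow> t \<notin> atoms \<Longrightarrow> isCont (rhs h) t"
  unfolding rhs_def[abs_def] atoms_def
  by (intro continuous_add K1.isCont_conv K2.isCont_conv) auto

lemma rhs_bounded:
  assumes "continuous_on UNIV h" "\<And>v. v < -\<tau> \<Longrightarrow> h v = h (-\<tau>)"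
  shows "\<exists>B\<ge>0. \<forall>t\<le>b. \<bar>rhs h t\<bar> \<le> B"
proof -
  obtain B where B: "0 \<le> B" "\<And>v. v \<in> {-\<tau>..max b (-\<tau>)} \<Longrightarrow> \<bar>h v\<bar> \<le> B"
    using K1.continuous_bounded_Icc[OF assms(1), of "-\<tau>" "max b (-\<tau>)"] by blast
  have *: "\<bar>h v\<bar> \<le> B" if "v \<le> b" for v
  proof (cases "v < -\<tau>")
    case True
    then show ?thesis using B(2)[of "-\<tau>"] assms(2)[OF True] by simp
  next
    case False
    then show ?thesis using that by (intro B(2)) auto
  qed
  have "\<bar>rhs h t\<bar> \<le> B * M" if "t \<le> b" for t
    using that B(1) by (intro abs_rhs_le[OF assms(1)] *) auto
  then show ?thesis using B(1) M_pos by (intro exI[of _ "B * M"]) simp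
qed

lemma rhs_integrable:
  assumes "continuous_on UNIV h" "\<And>v. v < -\<tau> \<Longrightarrow> h v = h (-\<tau>)"
  shows "rhs h integrable_on {a..b}"
proof -
  obtain B where B: "0 \<le> B" "\<And>t. t \<le> b \<Longrightarrow> \<bar>rhs h t\<bar> \<le> B" using rhs_bounded[OF assms, of b] by blast
  have [measurable]: "rhs h \<in> borel_measurable borel"
    unfolding rhs_def[abs_def] using K1.borel_measurable_conv K2.borel_measurable_conv assms(1)
    by (intro borel_measurable_add) auto
  have "set_integrable lborel {a..b} (rhs h)"
    unfolding set_integrable_def
  proof (rule Bochner_Integration.integrable_bound)
    show "integrable lborel (\<lambda>t. B * indicator {a..b} t)"
      by (intro integrable_mult_right integrable_real_indicator) (auto simp: emeasure_lborel_Icc_eq)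
    show "AE t in lborel. norm (indicator {a..b} t *\<^sub>R rhs h t) \<le> norm (B * indicator {a..b} t)"
      using B by (auto simp: indicator_def)
  qed auto
  then show ?thesis by (rule set_borel_integral_eq_integral)
qed

lemma forcing_cont: "continuous_on UNIV x \<Longrightarrow> continuous_on UNIV (\<lambda>v. f (x v))"
  by (rule continuous_on_compose2[OF f_cont]) auto

text \<open>Functions on \<open>[-\<tau>, \<infinity>)\<close> are extended to the left by their value at \<open>-\<tau>\<close>, so that continuity and
  measurability can be stated on the whole line.\<close>

definition history :: "(real \<Rightarrow> real) \<Rightarrow> bool" where
  "history x \<longleftrightarrow> continuous_on UNIV x \<and> (\<forall>t. t < -\<tau> \<longrightarrow> x t = x (-\<tau>)) \<and> (\<forall>t. 0 \<le> x t)"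

lemma history_psi: "history \<psi>"
  using psi_cont psi_left psi_pos by (auto simp: history_def intro: less_imp_le)

lemma history_forcing:
  assumes "history x"
  shows "continuous_on UNIV (\<lambda>v. f (x v))" "\<And>v. v < -\<tau> \<Longrightarrow> f (x v) = f (x (-\<tau>))"
  using assms forcing_cont by (auto simp: history_def)

lemma forcing_integrable: "history x \<Longrightarrow> rhs (\<lambda>v. f (x v)) integrable_on {a..b}"
  using history_forcing by (intro rhs_integrable) blast+

lemma forcing_bounded: "history x \<Longrightarrow> \<exists>B\<ge>0. \<forall>t\<le>b. \<bar>rhs (\<lambda>v. f (x v)) t\<bar> \<le> B"
  using history_forcing by (intro rhs_bounded) blast+

section \<open>The integral operator: regularity, contraction and growth\<close>

lemma picard_nonpos: "t \<le> 0 \<Longrightarrow> picard x t = \<psi> t"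
  by (cases "t = 0") (auto simp: picard_def)

lemma picard_increment:
  assumes "history x" "0 \<le> s" "s \<le> t"
  shows "picard x t - picard x s = integral {s..t} (rhs (\<lambda>v. f (x v)))"
  using Henstock_Kurzweil_Integration.integral_combine[OF assms(2,3) forcing_integrable[OF assms(1)]] psi_right[of s] psi_right[of t] assms
  by (cases "s = 0"; cases "t = 0") (auto simp: picard_def)

text \<open>The integrand is bounded on bounded intervals. This estimate is the source of both
  continuity and absolute continuity of the image.\<close>

lemma picard_lipschitz:
  assumes "history x"
  shows "\<exists>L. L-lipschitz_on {0..b} (picard x)"
proof -
  obtain B where B: "0 \<le> B" "\<And>t. t \<le> b \<Longrightarrow> \<bar>rhs (\<lambda>v. f (x v)) t\<bar> \<le> B"
    using forcing_bounded[OF assms, of b] by blast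
  have *: "\<bar>picard x t - picard x s\<bar> \<le> B * (t - s)" if "0 \<le> s" "s \<le> t" "t \<le> b" for s t
  proof -
    have "\<bar>integral {s..t} (rhs (\<lambda>v. f (x v)))\<bar> \<le> integral {s..t} (\<lambda>_. B)"
      using integral_norm_bound_integral[of "rhs (\<lambda>v. f (x v))" "{s..t}" "\<lambda>_. B"] forcing_integrable[OF assms] B that
      by (auto simp: real_norm_def)
    then show ?thesis using picard_increment[OF assms that(1,2)] that by (simp add: mult.commute)
  qed
  have "B-lipschitz_on {0..b} (picard x)"
  proof (rule lipschitz_onI)
    fix s t assume "s \<in> {0..b}" "t \<in> {0..b}"
    then show "dist (picard x s) (picard x t) \<le> B * dist s t"
      using *[of s t] *[of t s] by (cases "s \<le> t") (auto simp: dist_real_def abs_minus_commute)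
  qed (rule B(1))
  then show ?thesis ..
qed

lemma picard_ge_psi: "history x \<Longrightarrow> \<psi> t \<le> picard x t"
  unfolding picard_def using f_pos Henstock_Kurzweil_Integration.integral_nonneg[OF forcing_integrable, of x 0 t]
  by (simp add: rhs_nonneg less_imp_le)

lemma history_picard:
  assumes "history x"
  shows "history (picard x)"
  unfolding history_def
proof (intro conjI allI impI)
  show "continuous_on UNIV (picard x)"
  proof (rule continuous_on_UNIV_atMost)
    fix b
    obtain L where "L-lipschitz_on {0..b} (picard x)" using picard_lipschitz[OF assms] by blast
    then have "continuous_on {0..b} (picard x)" by (rule lipschitz_on_continuous_on)
    moreover have "continuous_on {..0} (picard x)"
      using psi_cont by (subst continuous_on_cong[OF refl, of _ _ \<psi>]) (auto simp: picard_nonpos intro: continuous_on_subset)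
    ultimately have "continuous_on ({..0} \<union> {0..b}) (picard x)" by (intro continuous_on_closed_Un) auto
    then show "continuous_on {..b} (picard x)" by (rule continuous_on_subset) auto
  qed
  show "0 \<le> picard x t" for t using picard_ge_psi[OF assms, of t] psi_pos[of t] by linarith
  show "picard x t = picard x (- \<tau>)" if "t < - \<tau>" for t
    using that tau psi_left by (simp add: picard_nonpos)
qed

lemma picard_deriv:
  assumes "history x" "0 < t" "t \<notin> atoms"
  shows "(picard x has_real_derivative rhs (\<lambda>v. f (x v)) t) (at t)"
proof -
  let ?g = "rhs (\<lambda>v. f (x v))"
  have "isCont ?g t" using history_forcing(1)[OF assms(1)] assms(3) by (rule isCont_rhs)
  then have "continuous (at t within ({0..t + 1} - {})) ?g" by (simp add: continuous_at_imp_continuous_at_within)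
  then have "((\<lambda>u. integral {0..u} ?g) has_vector_derivative ?g t) (at t within ({0..t + 1} - {}))"
    using assms by (intro integral_has_vector_derivative_continuous_at forcing_integrable) auto
  then have "((\<lambda>u. integral {0..u} ?g) has_real_derivative ?g t) (at t)"
    using assms(2) at_within_interior[of t "{0..t + 1}"]
    by (simp add: has_real_derivative_iff_has_vector_derivative)
  \<comment> \<open>Near a positive time \<open>\<psi>\<close> equals the constant
    \<open>\<psi> 0\<close>, so it contributes nothing to the derivative.\<close>
  then have "((\<lambda>u. \<psi> 0 + integral {0..u} ?g) has_real_derivative ?g t) (at t)"
    by (auto intro!: derivative_eq_intros)
  then show ?thesis
    by (rule has_field_derivative_transform_within_open[where S="{0<..}"])
      (use assms(2) in \<open>auto simp: picard_def psi_right\<close>)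
qed

text \<open>The equation looks only at earlier times, where the weight is no larger. At time
  \<open>u\<close> the two right-hand sides therefore differ by at most
  \<open>K * M * E * exp (2 * K * M * u)\<close>, half of \<open>E\<close> times the derivative of
  the weight; integration gives the factor 1/2. On the initial interval the weight is 1.\<close>

lemma picard_contraction:
  assumes "history x" "history y"
    and range: "\<And>v. v \<le> b \<Longrightarrow> x v \<le> B" "\<And>v. v \<le> b \<Longrightarrow> y v \<le> B"
    and K: "K-lipschitz_on {0..B} f" "0 < K"
    and close: "\<And>v. v \<le> b \<Longrightarrow> \<bar>x v - y v\<bar> \<le> E * exp (2 * K * M * max v 0)"
    and "t \<le> b"
  shows "\<bar>picard x t - picard y t\<bar> \<le> E / 2 * exp (2 * K * M * max t 0)"
proof -
  have "0 \<le> E * exp (2 * K * M * max t 0)" using close[OF \<open>t \<le> b\<close>] by linarith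
  then have E: "0 \<le> E" by (simp add: zero_le_mult_iff)
  show ?thesis
  proof (cases "t \<le> 0")
    case True
    then show ?thesis using E by (simp add: picard_nonpos)
  next
    case False
    define a where "a = 2 * K * M"
    have a: "0 < a" using K M_pos by (simp add: a_def)
    let ?h = "\<lambda>v. f (x v)" and ?k = "\<lambda>v. f (y v)"
    have "\<bar>rhs ?h u - rhs ?k u\<bar> \<le> E / 2 * (a * exp (a * u))" if "u \<in> {0..t}" for u
    proof -
      have "\<bar>rhs (\<lambda>v. ?h v - ?k v) u\<bar> \<le> (K * (E * exp (a * u))) * M"
      proof (rule abs_rhs_le)
        show "continuous_on UNIV (\<lambda>v. ?h v - ?k v)"
          using history_forcing(1) assms(1,2) by (intro continuous_on_diff) auto
        fix v assume v: "v \<le> u"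
        then have vb: "v \<le> b" using that \<open>t \<le> b\<close> by auto
        have "x v \<in> {0..B}" "y v \<in> {0..B}" using range[OF vb] assms(1,2) by (auto simp: history_def)
        then have "\<bar>?h v - ?k v\<bar> \<le> K * \<bar>x v - y v\<bar>"
          using lipschitz_onD[OF K(1)] by (simp add: dist_real_def)
        also have "\<dots> \<le> K * (E * exp (a * max v 0))"
          using close[OF vb] K(2) by (intro mult_left_mono) (auto simp: a_def)
        also have "\<dots> \<le> K * (E * exp (a * u))"
          using v that K(2) E a by (intro mult_left_mono) auto
        finally show "\<bar>?h v - ?k v\<bar> \<le> K * (E * exp (a * u))" .
      qed (use K E in auto)
      then show ?thesis using history_forcing(1) assms(1,2)
        by (simp add: rhs_diff a_def algebra_simps)
    qed
    then have "norm (integral {0..t} (\<lambda>u. rhs ?h u - rhs ?k u)) \<le> integral {0..t} (\<lambda>u. E / 2 * (a * exp (a * u)))"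
      using forcing_integrable[OF assms(1)] forcing_integrable[OF assms(2)]
        has_integral_mult_right[OF has_integral_exp[of t a], of "E / 2"] False
      by (intro integral_norm_bound_integral Henstock_Kurzweil_Integration.integrable_diff)
        (auto intro: has_integral_integrable)
    also have "\<dots> = E / 2 * (exp (a * t) - 1)"
      using has_integral_mult_right[OF has_integral_exp[of t a], of "E / 2"] False by (intro integral_unique) auto
    also have "\<dots> \<le> E / 2 * exp (a * t)" using E by (intro mult_left_mono) auto
    finally have "\<bar>integral {0..t} (\<lambda>u. rhs ?h u - rhs ?k u)\<bar> \<le> E / 2 * exp (a * t)" by simp
    then show ?thesis
      using False forcing_integrable[OF assms(1)] forcing_integrable[OF assms(2)]
      by (simp add: picard_def a_def Henstock_Kurzweil_Integration.integral_diff)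
  qed
qed

text \<open>The rate \<open>M * C\<close> makes the bound reproduce itself: integrating
  \<open>M * C * A * exp (M * C * u)\<close> yields \<open>A * exp (M * C * t) - A\<close>, and
  \<open>1 + \<psi> t \<le> A\<close> supplies the rest.\<close>

lemma picard_growth:
  assumes "history x" "0 < C" "\<And>u. 0 \<le> u \<Longrightarrow> f u \<le> C * (1 + u)"
    and psi_le: "\<And>v. 1 + \<psi> v \<le> A"
    and le: "\<And>v. 1 + x v \<le> A * exp (M * C * max v 0)"
  shows "1 + picard x t \<le> A * exp (M * C * max t 0)"
proof (cases "t \<le> 0")
  case True
  then show ?thesis using psi_le by (simp add: picard_nonpos)
next
  case False
  define a where "a = M * C"
  have a: "0 < a" using assms M_pos by (simp add: a_def)
  have A: "0 < A" using psi_le[of 0] psi_pos[of 0] by linarith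
  let ?h = "\<lambda>v. f (x v)"
  have "rhs ?h u \<le> A * (a * exp (a * u))" if "u \<in> {0..t}" for u
  proof -
    have "\<bar>rhs ?h u\<bar> \<le> (C * (A * exp (a * u))) * M"
    proof (rule abs_rhs_le[OF history_forcing(1)[OF assms(1)]])
      fix v assume v: "v \<le> u"
      have "?h v \<le> C * (1 + x v)" using assms(1,3) by (auto simp: history_def)
      also have "\<dots> \<le> C * (A * exp (a * max v 0))" using le[of v] assms(2) by (simp add: a_def)
      also have "\<dots> \<le> C * (A * exp (a * u))" using v that assms(2) A a by (intro mult_left_mono) auto
      finally show "\<bar>?h v\<bar> \<le> C * (A * exp (a * u))" using f_pos[of "x v"] by simp
    qed (use assms A in auto)
    then show ?thesis by (simp add: a_def algebra_simps)
  qed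
  then have "integral {0..t} (rhs ?h) \<le> integral {0..t} (\<lambda>u. A * (a * exp (a * u)))"
    using forcing_integrable[OF assms(1)] has_integral_mult_right[OF has_integral_exp[of t a], of A] False
    by (intro integral_le) (auto intro: has_integral_integrable)
  also have "\<dots> = A * (exp (a * t) - 1)"
    using has_integral_mult_right[OF has_integral_exp[of t a], of A] False by (intro integral_unique) auto
  finally show ?thesis
    using psi_le[of t] False by (simp add: picard_def a_def algebra_simps)
qed

end

section \<open>Existence and uniqueness of the fixed point\<close>

context delay_volterra
begin

text \<open>Holds for every history: constancy to the left of \<open>-\<tau>\<close> reduces the
  claim to a compact interval.\<close>

lemma picard_upper_bound:
  assumes "history x"
  shows "\<exists>B. \<forall>v\<le>b. x v \<le> B"
proof -
  obtain B where B: "\<forall>v\<in>{-\<tau>..max b (-\<tau>)}. \<bar>x v\<bar> \<le> B"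
    using K1.continuous_bounded_Icc[of x "-\<tau>" "max b (-\<tau>)"] assms by (auto simp: history_def)
  have "x v \<le> B" if "v \<le> b" for v
  proof (cases "v < -\<tau>")
    case True
    then have "x v = x (-\<tau>)" using assms by (simp add: history_def)
    then show ?thesis using B[THEN bspec, of "-\<tau>"] by simp
  next
    case False
    then show ?thesis using B[THEN bspec, of v] that by simp
  qed
  then show ?thesis by blast
qed

lemma f_lip_pos: "\<exists>K>0. K-lipschitz_on {0..B} f"
proof -
  obtain K where "K-lipschitz_on {0..B} f" using f_lip by blast
  then have "(max K 1)-lipschitz_on {0..B} f" by (rule lipschitz_on_mono) auto
  then show ?thesis by (intro exI[of _ "max K 1"]) auto
qed

text \<open>Comparing two iteration sequences covers both uses: constant sequences give uniqueness,
  a sequence and its shift give convergence. Initially both take values in \<open>{0..B}\<close>, so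
  they differ by at most \<open>B\<close>.\<close>

lemma picard_iterates_close:
  assumes X: "\<And>n. history (X n)" "\<And>n v. v \<le> b \<Longrightarrow> X n v \<le> B"
    and Y: "\<And>n. history (Y n)" "\<And>n v. v \<le> b \<Longrightarrow> Y n v \<le> B"
    and step: "\<And>n. X (Suc n) = picard (X n)" "\<And>n. Y (Suc n) = picard (Y n)"
    and K: "0 < K" "K-lipschitz_on {0..B} f"
    and "v \<le> b"
  shows "\<bar>X n v - Y n v\<bar> \<le> B / 2 ^ n * exp (2 * K * M * max v 0)"
  using \<open>v \<le> b\<close>
proof (induction n arbitrary: v)
  case 0
  have *: "0 \<le> X 0 v" "X 0 v \<le> B" "0 \<le> Y 0 v" "Y 0 v \<le> B"
    using X(1)[of 0] Y(1)[of 0] X(2)[OF 0] Y(2)[OF 0] by (auto simp: history_def)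
  then have "\<bar>X 0 v - Y 0 v\<bar> \<le> B * 1" by simp
  also have "\<dots> \<le> B * exp (2 * K * M * max v 0)" using * K(1) M_pos by (intro mult_left_mono) auto
  finally show ?case by simp
next
  case (Suc n)
  have "\<bar>picard (X n) v - picard (Y n) v\<bar> \<le> (B / 2 ^ n) / 2 * exp (2 * K * M * max v 0)"
    using Suc X Y K by (intro picard_contraction[where b=b and B=B]) auto
  then show ?case using step by simp
qed

lemma picard_unique:
  assumes "history x" "history y" "picard x = x" "picard y = y"
  shows "x = y"
proof
  fix t
  obtain B1 B2 where B: "\<forall>v\<le>t. x v \<le> B1" "\<forall>v\<le>t. y v \<le> B2"
    using picard_upper_bound assms(1,2) by metis
  define B where "B = max B1 B2"
  obtain K where K: "0 < K" "K-lipschitz_on {0..B} f" using f_lip_pos by blast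
  define E where "E = B * exp (2 * K * M * max t 0)"
  \<comment> \<open>A fixed point is a constant iteration sequence, so the bound holds for every
    \<open>n\<close>.\<close>
  have le: "\<bar>x t - y t\<bar> \<le> E * (1 / 2) ^ n" for n
    using picard_iterates_close[of "\<lambda>_. x" t B "\<lambda>_. y" K t n] assms B K
    by (auto simp: B_def E_def le_max_iff_disj power_one_over field_simps)
  have "(\<lambda>n. E * (1 / 2) ^ n) \<longlonglongrightarrow> E * 0"
    by (intro tendsto_mult tendsto_const LIMSEQ_power_zero) auto
  then have "\<bar>x t - y t\<bar> \<le> 0" using le by (intro LIMSEQ_le_const[of _ 0]) auto
  then show "x t = y t" by simp
qed

lemma psi_bounded: "\<exists>A. \<forall>v. 1 + \<psi> v \<le> A"
proof -
  obtain B where B: "\<forall>v\<le>0. \<psi> v \<le> B" using picard_upper_bound[OF history_psi] by blast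
  have "\<psi> v \<le> B" for v using B psi_right[of v] by (cases "0 < v") auto
  then show ?thesis by (intro exI[of _ "1 + B"]) simp
qed

lemma picard_fixed_point_exists: "\<exists>x. history x \<and> picard x = x"
proof -
  obtain C0 where C0: "\<forall>x\<ge>0. f x \<le> C0 * (1 + x)" using f_growth by blast
  define C where "C = max C0 1"
  have C: "0 < C" "\<And>u. 0 \<le> u \<Longrightarrow> f u \<le> C * (1 + u)"
  proof -
    fix u :: real assume u: "0 \<le> u"
    then have "C0 * (1 + u) \<le> C * (1 + u)" by (intro mult_right_mono) (auto simp: C_def)
    then show "f u \<le> C * (1 + u)" using C0[rule_format, OF u] by linarith
  qed (simp add: C_def)
  obtain A where A: "\<And>v. 1 + \<psi> v \<le> A" using psi_bounded by blast
  have A0: "0 < A" using A[of 0] psi_pos[of 0] by linarith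
  \<comment> \<open>The growth bound is uniform in \<open>n\<close>, so one Lipschitz constant of
    \<open>f\<close> serves all iterates up to a given time.\<close>
  define X where "X n = (picard ^^ n) \<psi>" for n
  have X_Suc: "X (Suc n) = picard (X n)" for n by (simp add: X_def)
  have hX: "history (X n)" for n
    by (induction n) (auto simp: X_def history_psi history_picard)
  have growth: "1 + X n v \<le> A * exp (M * C * max v 0)" for n v
  proof (induction n arbitrary: v)
    case 0
    have "1 + \<psi> v \<le> A * 1" using A by simp
    also have "\<dots> \<le> A * exp (M * C * max v 0)" using A0 C(1) M_pos by (intro mult_left_mono) auto
    finally show ?case by (simp add: X_def)
  next
    case (Suc n)
    show ?case unfolding X_Suc by (rule picard_growth[OF hX C A Suc])
  qed
  define Bd where "Bd b = A * exp (M * C * max b 0)" for b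
  have X_le: "X n v \<le> Bd b" if "v \<le> b" for n v b
  proof -
    have "A * exp (M * C * max v 0) \<le> Bd b"
      unfolding Bd_def using that A0 C(1) M_pos by (intro mult_left_mono) (auto intro!: mult_left_mono)
    then show ?thesis using growth[of n v] by linarith
  qed
  \<comment> \<open>Consecutive iterates differ by a geometric majorant; the telescoping series
    converges uniformly by the Weierstrass test.\<close>
  have conv: "uniformly_convergent_on {..b} X" for b
  proof -
    obtain K where K: "0 < K" "K-lipschitz_on {0..Bd b} f" using f_lip_pos by blast
    define E where "E = Bd b * exp (2 * K * M * max b 0)"
    have "\<bar>X (Suc n) v - X n v\<bar> \<le> E * (1 / 2) ^ n" if "v \<le> b" for n v
    proof -
      have "\<bar>X (Suc n) v - X n v\<bar> \<le> Bd b / 2 ^ n * exp (2 * K * M * max v 0)"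
        by (rule picard_iterates_close[of "\<lambda>n. X (Suc n)" b "Bd b" X K v n])
          (fact hX X_le X_Suc K that)+
      also have "\<dots> \<le> Bd b / 2 ^ n * exp (2 * K * M * max b 0)"
        using that K(1) M_pos A0 by (intro mult_left_mono) (auto simp: Bd_def intro!: mult_left_mono)
      finally show ?thesis by (simp add: E_def power_one_over field_simps)
    qed
    then have "uniformly_convergent_on {..b} (\<lambda>n v. \<Sum>i<n. X (Suc i) v - X i v)"
      by (intro Weierstrass_m_test'[where M="\<lambda>n. E * (1 / 2) ^ n"] summable_mult summable_geometric) auto
    moreover have "(\<lambda>n v. \<Sum>i<n. X (Suc i) v - X i v) = (\<lambda>n v. X n v - X 0 v)"
      using sum_lessThan_telescope[of "\<lambda>i. X i v" for v] by (intro ext) blast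
    ultimately have "uniformly_convergent_on {..b} (\<lambda>n v. X n v - X 0 v)" by simp
    then obtain l where "uniform_limit {..b} (\<lambda>n v. X n v - X 0 v) l sequentially"
      by (auto simp: uniformly_convergent_on_def)
    then have "uniform_limit {..b} (\<lambda>n v. X n v - X 0 v + X 0 v) (\<lambda>v. l v + X 0 v) sequentially"
      by (intro uniform_limit_add uniform_limit_const)
    then show ?thesis by (auto simp: uniformly_convergent_on_def)
  qed
  define x where "x t = lim (\<lambda>n. X n t)" for t
  have ulim: "uniform_limit {..b} X x sequentially" for b
    using conv[of b] unfolding uniformly_convergent_uniform_limit_iff x_def[abs_def] .
  have plim: "(\<lambda>n. X n t) \<longlonglongrightarrow> x t" for t
    using ulim[of t] by (rule tendsto_uniform_limitI) simp
  have hx: "history x"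
    unfolding history_def
  proof (intro conjI allI impI)
    show "continuous_on UNIV x"
    proof (rule continuous_on_UNIV_atMost)
      fix b
      show "continuous_on {..b} x"
        using hX by (intro uniform_limit_theorem[OF _ ulim])
          (auto simp: history_def intro!: always_eventually intro: continuous_on_subset)
    qed
    show "x t = x (-\<tau>)" if "t < -\<tau>" for t
      using hX that by (auto simp: x_def history_def)
    show "0 \<le> x t" for t
      using hX by (intro LIMSEQ_le_const[OF plim[of t]]) (auto simp: history_def)
  qed
  have "picard x t = x t" for t
  proof (rule LIMSEQ_unique)
    show "(\<lambda>n. X (Suc n) t) \<longlonglongrightarrow> x t" using plim by (rule LIMSEQ_Suc)
    obtain K where K: "0 < K" "K-lipschitz_on {0..Bd t} f" using f_lip_pos by blast
    \<comment> \<open>\<open>E\<close> is the largest weight up to time \<open>t\<close>: uniform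
      distance \<open>e / E\<close> before applying \<open>picard\<close> becomes at most
      \<open>e / 2\<close> at \<open>t\<close> afterwards.\<close>
    define E where "E = exp (2 * K * M * max t 0)"
    have x_le: "x v \<le> Bd t" if "v \<le> t" for v
      using X_le[OF that] by (intro LIMSEQ_le_const2[OF plim[of v]]) auto
    show "(\<lambda>n. X (Suc n) t) \<longlonglongrightarrow> picard x t"
      unfolding tendsto_iff
    proof (intro allI impI)
      fix e :: real assume e: "0 < e"
      then have "0 < e / E" by (simp add: E_def)
      then have "\<forall>\<^sub>F n in sequentially. \<forall>v\<in>{..t}. dist (X n v) (x v) < e / E"
        by (rule uniform_limitD[OF ulim])
      then show "\<forall>\<^sub>F n in sequentially. dist (X (Suc n) t) (picard x t) < e"
      proof eventually_elim
        case (elim n)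
        have "\<bar>X n v - x v\<bar> \<le> e / E * exp (2 * K * M * max v 0)" if "v \<le> t" for v
        proof -
          have "\<bar>X n v - x v\<bar> \<le> e / E * 1" using elim that by (force simp: dist_real_def)
          also have "\<dots> \<le> e / E * exp (2 * K * M * max v 0)"
            using e K(1) M_pos by (intro mult_left_mono) (auto simp: E_def)
          finally show ?thesis .
        qed
        then have "\<bar>picard (X n) t - picard x t\<bar> \<le> e / E / 2 * E"
          unfolding E_def using hX hx X_le x_le K by (intro picard_contraction[where b=t and B="Bd t"]) (auto simp: E_def)
        also have "\<dots> = e / 2" by (simp add: E_def)
        finally show ?case using e by (simp add: X_Suc dist_real_def)
      qed
    qed
  qed
  then show ?thesis using hx by auto
qed

lemma AE_not_atoms: "AE t in lborel. t \<notin> atoms"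
  using countable_imp_null_set_lborel[OF countable_atoms] by (rule AE_not_in)

lemma fixed_point_abs_continuous:
  "history x \<Longrightarrow> abs_continuous_on_interval 0 b (picard x)"
  using picard_lipschitz abs_continuous_on_interval_lipschitz by blast

text \<open>Both functions have the same derivative outside a null set, as the atoms are countable.
  The increment bound is one-sided and is therefore applied to the difference in both
  orders.\<close>

lemma picard_eq_of_AE_deriv:
  assumes y: "history y" "\<And>t. t \<le> 0 \<Longrightarrow> y t = \<psi> t"
    and ac: "\<And>b. 0 < b \<Longrightarrow> abs_continuous_on_interval 0 b y"
    and der: "AE t in lborel. 0 < t \<longrightarrow> (y has_real_derivative rhs (\<lambda>v. f (y v)) t) (at t)"
  shows "picard y = y"
proof
  fix t
  show "picard y t = y t"
  proof (cases "t \<le> 0")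
    case True
    then show ?thesis using y(2) by (simp add: picard_nonpos)
  next
    case False
    have 0: "picard y 0 = y 0" using y(2) by (simp add: picard_nonpos)
    note acs = ac[of t] fixed_point_abs_continuous[OF y(1), of t]
    have "(y t - picard y t) - (y 0 - picard y 0) \<le> 0 * (t - 0)"
    proof (rule abs_continuous_increment_le)
      show "abs_continuous_on_interval 0 t (\<lambda>t. y t - picard y t)"
        using acs False by (intro abs_continuous_on_interval_diff) auto
      show "AE s in lborel. 0 < s \<and> s < t \<longrightarrow>
          (\<exists>D\<le>0. ((\<lambda>t. y t - picard y t) has_real_derivative D) (at s))"
        using der AE_not_atoms
      proof eventually_elim
        case (elim s)
        then show ?case using DERIV_diff[OF _ picard_deriv[OF y(1)]] by fastforce
      qed
    qed (use False in auto)
    moreover have "(picard y t - y t) - (picard y 0 - y 0) \<le> 0 * (t - 0)"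
    proof (rule abs_continuous_increment_le)
      show "abs_continuous_on_interval 0 t (\<lambda>t. picard y t - y t)"
        using acs False by (intro abs_continuous_on_interval_diff) auto
      show "AE s in lborel. 0 < s \<and> s < t \<longrightarrow>
          (\<exists>D\<le>0. ((\<lambda>t. picard y t - y t) has_real_derivative D) (at s))"
        using der AE_not_atoms
      proof eventually_elim
        case (elim s)
        then show ?case using DERIV_diff[OF picard_deriv[OF y(1)]] by fastforce
      qed
    qed (use False in auto)
    ultimately show ?thesis using 0 by simp
  qed
qed

end

section \<open>Asymptotics\<close>

text \<open>Beyond some \<open>T\<close> the derivative is within \<open>e / 2\<close> of
  \<open>M\<close>, so increments from \<open>T\<close> on are controlled by applying the increment
  bound to \<open>g\<close> and to \<open>- g\<close>.\<close>

lemma tendsto_quotient_of_AE_deriv: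
  fixes g r :: "real \<Rightarrow> real"
  assumes lip: "\<And>b. \<exists>L. L-lipschitz_on {0..b} g"
    and der: "AE t in lborel. 0 < t \<longrightarrow> (g has_real_derivative r t) (at t)"
    and r: "(r \<longlongrightarrow> M) at_top"
  shows "((\<lambda>t. g t / t) \<longlongrightarrow> M) at_top"
  unfolding tendsto_iff
proof (intro allI impI)
  fix e :: real assume e: "0 < e"
  then have "\<forall>\<^sub>F t in at_top. dist (r t) M < e / 2" using r by (intro tendstoD) auto
  then obtain T0 where T0: "\<And>t. T0 \<le> t \<Longrightarrow> \<bar>r t - M\<bar> < e / 2"
    by (auto simp: eventually_at_top_linorder dist_real_def)
  define T where "T = max T0 0"
  have *: "\<bar>g t - g T - M * (t - T)\<bar> \<le> e / 2 * (t - T)" if "T \<le> t" for t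
  proof -
    obtain L where L: "L-lipschitz_on {0..t} g" using lip by blast
    have L1: "L-lipschitz_on {T..t} g" by (rule lipschitz_on_subset[OF L]) (auto simp: T_def)
    have L2: "L-lipschitz_on {T..t} (\<lambda>s. - g s)" using L1 by (intro lipschitz_intros)
    have "g t - g T \<le> (M + e / 2) * (t - T)"
    proof (rule abs_continuous_increment_le[OF that abs_continuous_on_interval_lipschitz[OF L1]])
      show "AE s in lborel. T < s \<and> s < t \<longrightarrow> (\<exists>D\<le>M + e / 2. (g has_real_derivative D) (at s))"
        using der
      proof eventually_elim
        case (elim s)
        show ?case
        proof
          assume s: "T < s \<and> s < t"
          then have "r s < M + e / 2" "M - e / 2 < r s" using T0[of s] unfolding T_def by linarith+
          with s show "\<exists>D\<le>M + e / 2. (g has_real_derivative D) (at s)"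
            using elim by (intro exI[of _ "r s"]) (auto simp: T_def)
        qed
      qed
    qed
    moreover have "- g t - - g T \<le> (- M + e / 2) * (t - T)"
    proof (rule abs_continuous_increment_le[OF that abs_continuous_on_interval_lipschitz[OF L2]])
      show "AE s in lborel. T < s \<and> s < t \<longrightarrow> (\<exists>D\<le>- M + e / 2. ((\<lambda>s. - g s) has_real_derivative D) (at s))"
        using der
      proof eventually_elim
        case (elim s)
        show ?case
        proof
          assume s: "T < s \<and> s < t"
          then have "r s < M + e / 2" "M - e / 2 < r s" using T0[of s] unfolding T_def by linarith+
          with s show "\<exists>D\<le>- M + e / 2. ((\<lambda>s. - g s) has_real_derivative D) (at s)"
            using elim by (intro exI[of _ "- r s"]) (auto simp: T_def intro: DERIV_minus)
        qed
      qed
    qed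
    ultimately show ?thesis unfolding distrib_right mult_minus_left abs_le_iff by linarith
  qed
  define c where "c = \<bar>g T - M * T\<bar>"
  \<comment> \<open>From this time on, the discrepancy \<open>c\<close> at time \<open>T\<close> is
    less than \<open>e / 2 * t\<close>.\<close>
  have "\<forall>\<^sub>F t in at_top. max T (2 * c / e) < t \<and> 0 < t"
    by (intro eventually_conj eventually_gt_at_top)
  then show "\<forall>\<^sub>F t in at_top. dist (g t / t) M < e"
  proof eventually_elim
    case (elim t)
    have "\<bar>g t - M * t\<bar> \<le> e / 2 * (t - T) + c"
    proof -
      have "g t - M * t = (g t - g T - M * (t - T)) + (g T - M * T)" by (simp add: algebra_simps)
      then show ?thesis using *[of t] elim unfolding c_def by linarith
    qed
    also have "\<dots> \<le> e / 2 * t + c" using e by (simp add: T_def)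
    also have "\<dots> < e * t" using elim e by (simp add: field_simps)
    finally have "\<bar>g t - M * t\<bar> / t < e" using elim by (simp add: divide_less_eq)
    moreover have "g t / t - M = (g t - M * t) / t" using elim by (simp add: field_simps)
    ultimately show ?case using elim by (simp add: dist_real_def)
  qed
qed

section \<open>The comparison function and its consequences for f\<close>

lemma classS_deriv:
  assumes "\<phi> \<in> classS" "0 < u"
  shows "(\<phi> has_real_derivative deriv \<phi> u) (at u)"
proof -
  obtain D where "(\<phi> has_vector_derivative D u) (at u)"
    using assms by (auto simp: classS_def C1_differentiable_on_def)
  then have "(\<phi> has_real_derivative D u) (at u)" by (simp add: has_real_derivative_iff_has_vector_derivative)
  then show ?thesis by (simp add: DERIV_imp_deriv)
qed

lemma classS_MVT:
  assumes "\<phi> \<in> classS" "0 \<le> u" "u < v"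
  shows "\<exists>z. u < z \<and> z < v \<and> \<phi> v - \<phi> u = (v - u) * deriv \<phi> z"
proof -
  have "continuous_on {u..v} \<phi>" using assms by (auto simp: classS_def intro: continuous_on_subset)
  moreover have "\<phi> differentiable (at z)" if "u < z" "z < v" for z
    using classS_deriv[OF assms(1), of z] that assms(2) by (auto simp: real_differentiable_def)
  ultimately obtain l z where "u < z" "z < v" "DERIV \<phi> z :> l" "\<phi> v - \<phi> u = (v - u) * l"
    using MVT[OF assms(3), of \<phi>] by blast
  then show ?thesis by (metis DERIV_imp_deriv)
qed

lemma classS_mono:
  assumes "\<phi> \<in> classS" "0 \<le> u" "u \<le> v"
  shows "\<phi> u \<le> \<phi> v"
proof (cases "u = v")
  case False
  then obtain z where "u < z" "\<phi> v - \<phi> u = (v - u) * deriv \<phi> z" using classS_MVT[OF assms(1,2), of v] assms by auto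
  moreover have "0 < deriv \<phi> z" using assms \<open>u < z\<close> by (auto simp: classS_def)
  ultimately show ?thesis using assms(3) by (smt (verit) mult_nonneg_nonneg)
qed simp

lemma classS_slowly_growing:
  assumes "\<phi> \<in> classS" "0 < e"
  shows "\<exists>X>0. \<forall>u v. X \<le> u \<longrightarrow> u \<le> v \<longrightarrow> \<phi> v - \<phi> u \<le> e * (v - u)"
proof -
  have "\<forall>\<^sub>F u in at_top. deriv \<phi> u < e" using assms by (intro order_tendstoD) (auto simp: classS_def)
  then obtain X where X: "\<And>u. X \<le> u \<Longrightarrow> deriv \<phi> u < e" by (auto simp: eventually_at_top_linorder)
  have "\<phi> v - \<phi> u \<le> e * (v - u)" if uv: "max X 1 \<le> u" "u \<le> v" for u v
  proof (cases "u = v")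
    case False
    then obtain z where "u < z" "\<phi> v - \<phi> u = (v - u) * deriv \<phi> z" using classS_MVT[OF assms(1), of u v] uv by auto
    moreover have "deriv \<phi> z < e" using X uv \<open>u < z\<close> by auto
    ultimately show ?thesis using uv by (simp add: mult.commute mult_right_mono)
  qed simp
  then show ?thesis by (intro exI[of _ "max X 1"]) auto
qed

lemma asymp_classS_bounds:
  fixes f :: "real \<Rightarrow> real"
  assumes phi: "\<phi> \<in> classS" "((\<lambda>x. f x / \<phi> x) \<longlongrightarrow> 1) at_top" and e: "0 < e"
  shows "\<exists>X>0. \<forall>u\<ge>X. (1 - e) * \<phi> u \<le> f u \<and> f u \<le> (1 + e) * \<phi> u"
proof -
  have "\<forall>\<^sub>F u in at_top. dist (f u / \<phi> u) 1 < e" using phi(2) e by (auto simp: tendsto_iff)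
  then obtain X where X: "\<And>u. X \<le> u \<Longrightarrow> \<bar>f u / \<phi> u - 1\<bar> < e"
    by (auto simp: eventually_at_top_linorder dist_real_def)
  have "(1 - e) * \<phi> u \<le> f u \<and> f u \<le> (1 + e) * \<phi> u" if "max X 1 \<le> u" for u
  proof -
    have "0 < \<phi> u" using phi(1) that by (auto simp: classS_def)
    moreover have "1 - e \<le> f u / \<phi> u" "f u / \<phi> u \<le> 1 + e" using X[of u] that by auto
    ultimately show ?thesis by (simp add: field_simps)
  qed
  then show ?thesis by (intro exI[of _ "max X 1"]) auto
qed

text \<open>Beyond \<open>X\<close> the slope of \<phi> is at most 1 and
  \<open>f \<le> 2 * \<phi>\<close>; below \<open>X\<close> compactness gives \<open>B\<close>. The
  constant adds up the bounds of both ranges.\<close>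

lemma asymp_classS_linear_growth:
  fixes f :: "real \<Rightarrow> real"
  assumes phi: "\<phi> \<in> classS" "((\<lambda>x. f x / \<phi> x) \<longlongrightarrow> 1) at_top" and f: "continuous_on {0..} f"
  shows "\<exists>C. \<forall>u\<ge>0. f u \<le> C * (1 + u)"
proof -
  obtain X1 where X1: "X1 > 0" "\<And>u. u \<ge> X1 \<Longrightarrow> f u \<le> (1 + 1) * \<phi> u" using asymp_classS_bounds[OF phi, of 1] by auto
  obtain X2 where X2: "X2 > 0" "\<And>u v. X2 \<le> u \<Longrightarrow> u \<le> v \<Longrightarrow> \<phi> v - \<phi> u \<le> 1 * (v - u)"
    using classS_slowly_growing[OF phi(1), of 1] by auto
  define X where "X = max X1 X2"
  have "bounded (f ` {0..X})"
    using f by (intro compact_imp_bounded compact_continuous_image) (auto intro: continuous_on_subset)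
  then obtain B where B: "0 < B" "\<forall>y\<in>f ` {0..X}. norm y \<le> B" by (auto simp: bounded_pos)
  have pX: "0 < \<phi> X" using phi(1) X1 by (auto simp: classS_def X_def)
  have "f u \<le> (B + 2 * \<phi> X + 2) * (1 + u)" if "0 \<le> u" for u
  proof (cases "u \<le> X")
    case True
    then have "f u \<le> B * 1" using B(2) that by force
    also have "\<dots> \<le> (B + 2 * \<phi> X + 2) * (1 + u)" using B(1) pX that by (intro mult_mono) auto
    finally show ?thesis .
  next
    case False
    have X: "X1 \<le> X" "X2 \<le> X" by (auto simp: X_def)
    then have "f u \<le> 2 * \<phi> u" "\<phi> u \<le> \<phi> X + u" using X1(2)[of u] X2(2)[of X u] X1(1) False by auto
    then have "f u \<le> 2 * \<phi> X + 2 * u" by simp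
    also have "\<dots> \<le> (B + 2 * \<phi> X + 2) * (1 + u)" using B(1) pX that by (simp add: algebra_simps)
    finally show ?thesis .
  qed
  then show ?thesis by blast
qed

text \<open>For large arguments \<open>f\<close> exceeds half of \<phi>, which is at least
  \<open>\<phi> 0\<close>; compactness handles the rest. The bound drives the solution to infinity
  and makes the primitive of \<open>1 / f\<close> Lipschitz.\<close>

lemma asymp_classS_lower_bound:
  fixes f :: "real \<Rightarrow> real"
  assumes phi: "\<phi> \<in> classS" "((\<lambda>x. f x / \<phi> x) \<longlongrightarrow> 1) at_top"
    and f: "continuous_on {0..} f" "\<And>u. 0 \<le> u \<Longrightarrow> 0 < f u"
  shows "\<exists>m>0. \<forall>u\<ge>0. m \<le> f u"
proof -
  obtain X where X: "X > 0" "\<And>u. u \<ge> X \<Longrightarrow> (1 - 1 / 2) * \<phi> u \<le> f u" using asymp_classS_bounds[OF phi, of "1 / 2"] by auto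
  have "\<exists>w\<in>{0..X}. \<forall>y\<in>{0..X}. f w \<le> f y"
    using X(1) f(1) by (intro continuous_attains_inf) (auto intro: continuous_on_subset)
  then obtain w where w: "w \<in> {0..X}" "\<And>y. y \<in> {0..X} \<Longrightarrow> f w \<le> f y" by blast
  have p0: "0 < \<phi> 0" using phi(1) by (auto simp: classS_def)
  have "min (f w) (\<phi> 0 / 2) \<le> f u" if "0 \<le> u" for u
  proof (cases "u \<le> X")
    case False
    then have "\<phi> 0 / 2 \<le> f u" using X(2)[of u] classS_mono[OF phi(1), of 0 u] that by auto
    then show ?thesis by simp
  qed (use w(2)[of u] that in auto)
  then show ?thesis using f(2)[of w] w(1) p0 by (intro exI[of _ "min (f w) (\<phi> 0 / 2)"]) auto
qed

text \<open>The bound on \<open>f u * G u / u\<close> turns relative closeness of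
  \<open>G (x t)\<close> and \<open>M * t\<close> into relative closeness of their preimages,
  measured by differences of logarithms.\<close>

lemma inverse_asymptotics:
  fixes f G x :: "real \<Rightarrow> real"
  assumes f: "\<And>u. 0 < u \<Longrightarrow> 0 < f u"
    and G: "\<And>u. 0 < u \<Longrightarrow> (G has_real_derivative 1 / f u) (at u)" "G 1 = 0"
    and L: "0 < L" "\<forall>\<^sub>F u in at_top. f u * G u / u \<le> L"
    and M: "0 < M"
    and x: "filterlim x at_top at_top" "((\<lambda>t. G (x t) / (M * t)) \<longlongrightarrow> 1) at_top"
  shows "((\<lambda>t. x t / the_inv_into {0<..} G (M * t)) \<longlongrightarrow> 1) at_top"
proof -
  have cont: "isCont G u" if "0 < u" for u using G(1)[OF that] by (rule DERIV_isCont)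
  have strict: "G u < G v" if "0 < u" "u < v" for u v
  proof (rule DERIV_pos_imp_increasing[OF that(2)])
    fix s assume "u \<le> s" "s \<le> v"
    then show "\<exists>y. DERIV G s :> y \<and> 0 < y" using G(1)[of s] f[of s] that by (intro exI[of _ "1 / f s"]) auto
  qed
  then have inj: "inj_on G {0<..}"
    by (intro inj_onI) (metis greaterThan_iff less_irrefl linorder_neqE_linordered_idom)
  have Gx: "filterlim (\<lambda>t. G (x t)) at_top at_top"
  proof -
    have "filterlim (\<lambda>t. G (x t) / (M * t) * (M * t)) at_top at_top"
      using M by (intro filterlim_tendsto_pos_mult_at_top[OF x(2)] filterlim_tendsto_pos_mult_at_top[OF tendsto_const] filterlim_ident) auto
    moreover have "\<forall>\<^sub>F t in at_top. G (x t) / (M * t) * (M * t) = G (x t)"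
      using eventually_gt_at_top[of 0] by eventually_elim (use M in simp)
    ultimately show ?thesis by (rule filterlim_mono_eventually[OF _ order_refl order_refl])
  qed
  define z where "z t = the_inv_into {0<..} G (M * t)" for t
  \<comment> \<open>The function \<open>G\<close> attains \<open>M * t\<close> between 1 and a large
    value of \<open>x\<close>, because \<open>G (x s)\<close> is unbounded; so the inverse is
    applied inside its domain.\<close>
  have z: "0 < z t \<and> G (z t) = M * t" if "0 < t" for t
  proof -
    have "\<forall>\<^sub>F s in at_top. M * t \<le> G (x s) \<and> 1 \<le> x s"
      using Gx x(1) by (intro eventually_conj) (auto simp: filterlim_at_top)
    then obtain s where "M * t \<le> G (x s)" "1 \<le> x s"
      by (auto simp: eventually_at_top_linorder)
    moreover have "0 \<le> M * t" using M that by simp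
    ultimately obtain w where w: "1 \<le> w" "G w = M * t"
      using IVT[of G 1 "M * t" "x s"] cont G(2) by auto
    then have "M * t \<in> G ` {0<..}" by (intro image_eqI[of _ _ w]) auto
    then show ?thesis
      using f_the_inv_into_f[OF inj] the_inv_into_into[OF inj _ order_refl] by (auto simp: z_def)
  qed
  have z_lim: "filterlim z at_top at_top"
    unfolding filterlim_at_top
  proof
    fix Z
    have "\<forall>\<^sub>F t in at_top. max 0 (G (max Z 1) / M) < t" by (rule eventually_gt_at_top)
    then show "\<forall>\<^sub>F t in at_top. Z \<le> z t"
    proof eventually_elim
      case (elim t)
      then have "G (max Z 1) < G (z t)" using z[of t] M by (auto simp: field_simps)
      then have "\<not> z t < max Z 1" using strict[of "z t" "max Z 1"] z[of t] elim by auto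
      then show ?case by simp
    qed
  qed
  obtain X1 where X1: "\<And>u. X1 \<le> u \<Longrightarrow> f u * G u / u \<le> L" using L(2) by (auto simp: eventually_at_top_linorder)
  \<comment> \<open>The bound 2 keeps arguments beyond the zero 1 of \<open>G\<close>, so that
    \<open>ln (G u)\<close> is meaningful.\<close>
  define X where "X = max X1 2"
  have Gpos: "0 < G u" if "1 < u" for u using strict[of 1 u] that G(2) by simp
  have ln_le: "ln v - ln u \<le> L * (ln (G v) - ln (G u))" if "X \<le> u" "u \<le> v" for u v
  proof -
    \<comment> \<open>The derivative \<open>L / (G s * f s) - 1 / s\<close> is nonnegative exactly
      when \<open>f s * G s / s \<le> L\<close>.\<close>
    have "L * ln (G u) - ln u \<le> L * ln (G v) - ln v"
    proof (rule DERIV_nonneg_imp_nondecreasing[OF that(2)])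
      fix s assume "u \<le> s" "s \<le> v"
      then have s: "1 < s" "X1 \<le> s" using that by (auto simp: X_def)
      have "((\<lambda>s. L * ln (G s) - ln s) has_real_derivative L * (1 / G s * (1 / f s)) - 1 / s) (at s)"
        using s Gpos[of s] by (auto intro!: derivative_eq_intros G(1) simp: divide_simps)
      moreover have "1 / s \<le> L * (1 / G s * (1 / f s))"
        using X1[OF s(2)] s Gpos[of s] f[of s] by (simp add: field_simps)
      ultimately show "\<exists>y. ((\<lambda>s. L * ln (G s) - ln s) has_real_derivative y) (at s) \<and> 0 \<le> y" by force
    qed
    then show ?thesis by (simp add: algebra_simps)
  qed
  have ln_abs: "\<bar>ln v - ln u\<bar> \<le> L * \<bar>ln (G v) - ln (G u)\<bar>" if "X \<le> u" "X \<le> v" for u v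
  proof -
    have *: "L * (ln (G v) - ln (G u)) \<le> L * \<bar>ln (G v) - ln (G u)\<bar>" "L * (ln (G u) - ln (G v)) \<le> L * \<bar>ln (G v) - ln (G u)\<bar>"
      using L(1) by (auto intro!: mult_left_mono)
    have mono: "ln u \<le> ln v" if "X \<le> u" "u \<le> v" for u v using that by (simp add: X_def)
    show ?thesis
    proof (cases "u \<le> v")
      case True
      then show ?thesis using ln_le[of u v] mono[of u v] * that by linarith
    next
      case False
      then show ?thesis using ln_le[of v u] mono[of v u] * that by linarith
    qed
  qed
  have ev: "\<forall>\<^sub>F t in at_top. 0 < t \<and> X \<le> x t \<and> X \<le> z t"
    using x(1) z_lim by (intro eventually_conj eventually_gt_at_top) (auto simp: filterlim_at_top)
  have "((\<lambda>t. L * \<bar>ln (G (x t) / (M * t))\<bar>) \<longlongrightarrow> L * \<bar>ln 1\<bar>) at_top"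
    using x(2) by (intro tendsto_intros) auto
  then have lim0: "((\<lambda>t. L * \<bar>ln (G (x t) / (M * t))\<bar>) \<longlongrightarrow> 0) at_top" by simp
  have "((\<lambda>t. ln (x t) - ln (z t)) \<longlongrightarrow> 0) at_top"
  proof (rule Lim_null_comparison[OF _ lim0])
    show "\<forall>\<^sub>F t in at_top. norm (ln (x t) - ln (z t)) \<le> L * \<bar>ln (G (x t) / (M * t))\<bar>"
      using ev
    proof eventually_elim
      case (elim t)
      then have "\<bar>ln (x t) - ln (z t)\<bar> \<le> L * \<bar>ln (G (x t)) - ln (G (z t))\<bar>" by (intro ln_abs) auto
      moreover have "ln (G (x t)) - ln (G (z t)) = ln (G (x t) / (M * t))"
        using elim z[of t] M Gpos[of "x t"] by (simp add: X_def ln_div)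
      ultimately show ?case by simp
    qed
  qed
  then have "((\<lambda>t. exp (ln (x t) - ln (z t))) \<longlongrightarrow> exp 0) at_top" by (rule tendsto_exp)
  moreover have "\<forall>\<^sub>F t in at_top. exp (ln (x t) - ln (z t)) = x t / z t"
    using ev by eventually_elim (auto simp: exp_diff X_def)
  ultimately have "((\<lambda>t. x t / z t) \<longlongrightarrow> exp 0) at_top" by (rule Lim_transform_eventually)
  then show ?thesis by (simp add: z_def)
qed

section \<open>Growth of the solution\<close>

locale delay_asymptotics = delay_volterra +
  fixes \<phi> x :: "real \<Rightarrow> real"
  assumes phi: "\<phi> \<in> classS" "((\<lambda>u. f u / \<phi> u) \<longlongrightarrow> 1) at_top"
    and hx: "history x" and fixed: "picard x = x"
begin

abbreviation "h \<equiv> \<lambda>v. f (x v)"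

lemma h_cont: "continuous_on UNIV h"
  using history_forcing(1)[OF hx] .

lemma x_nonneg: "0 \<le> x t"
  using hx by (simp add: history_def)

lemma x_increment: "0 \<le> s \<Longrightarrow> s \<le> t \<Longrightarrow> x t - x s = integral {s..t} (rhs h)"
  using picard_increment[OF hx] fixed by simp

lemma h_integrable: "rhs h integrable_on {a..b}"
  using forcing_integrable[OF hx] .

lemma h_nonneg: "0 \<le> h v"
  using f_pos less_imp_le by blast

lemma x_mono: "0 \<le> s \<Longrightarrow> s \<le> t \<Longrightarrow> x s \<le> x t"
  using x_increment[of s t] Henstock_Kurzweil_Integration.integral_nonneg[OF h_integrable, of s t]
    rhs_nonneg[of h] h_nonneg by force

lemma x_lower_increment:
  assumes "0 \<le> s" "s \<le> t" "\<And>u. s \<le> u \<Longrightarrow> u \<le> t \<Longrightarrow> c \<le> rhs h u"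
  shows "c * (t - s) \<le> x t - x s"
proof -
  have "integral {s..t} (\<lambda>_. c) \<le> integral {s..t} (rhs h)"
    using assms(3) by (intro integral_le h_integrable) auto
  then show ?thesis using x_increment[OF assms(1,2)] assms(2) by (simp add: mult.commute)
qed

lemma x_upper_increment:
  assumes "0 \<le> s" "s \<le> t" "\<And>u. s \<le> u \<Longrightarrow> u \<le> t \<Longrightarrow> rhs h u \<le> c"
  shows "x t - x s \<le> c * (t - s)"
proof -
  have "integral {s..t} (rhs h) \<le> integral {s..t} (\<lambda>_. c)"
    using assms(3) by (intro integral_le h_integrable) auto
  then show ?thesis using x_increment[OF assms(1,2)] assms(2) by (simp add: mult.commute)
qed

lemma tails_small:
  assumes "0 < e"
  shows "\<exists>T0\<ge>0. \<forall>T\<ge>T0. measure N1 {T<..} + measure N2 {T<..} < e"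
proof -
  obtain T1 where T1: "\<And>T. T1 \<le> T \<Longrightarrow> measure N1 {T<..} < e / 2" using K1.tail_small[of "e / 2"] assms by auto
  obtain T2 where T2: "\<And>T. T2 \<le> T \<Longrightarrow> measure N2 {T<..} < e / 2" using K2.tail_small[of "e / 2"] assms by auto
  have "measure N1 {T<..} + measure N2 {T<..} < e" if "max (max T1 T2) 0 \<le> T" for T
    using T1[of T] T2[of T] that by simp
  then show ?thesis by (intro exI[of _ "max (max T1 T2) 0"]) auto
qed

lemma rhs_ge_window:
  assumes "0 \<le> S" "0 \<le> T" "T \<le> t" "\<And>v. t - T \<le> v \<Longrightarrow> v \<le> t \<Longrightarrow> S \<le> h v"
  shows "S * (M - (measure N1 {T<..} + measure N2 {T<..})) \<le> rhs h t"
proof -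
  have "S * measure N1 {..T} \<le> K1.conv \<tau> h t" "S * measure N2 {..T} \<le> K2.conv 0 h t"
    using assms tau h_nonneg by (auto intro!: K1.conv_ge K2.conv_ge h_cont)
  then show ?thesis
    by (simp add: rhs_def K1.measure_atMost_tail K2.measure_atMost_tail M_eq[symmetric] algebra_simps)
qed

lemma f_lower_bound: "\<exists>m>0. \<forall>u\<ge>0. m \<le> f u"
  by (rule asymp_classS_lower_bound[OF phi]) (auto intro: continuous_on_subset[OF f_cont] f_pos)

text \<open>Once delays up to \<open>T\<close> carry at least half of the mass, the lower bound
  \<open>m\<close> of \<open>f\<close> keeps the right-hand side above \<open>m * M / 2\<close>, and
  the solution grows at least linearly.\<close>

lemma x_at_top: "filterlim x at_top at_top"
proof -
  obtain m where m: "0 < m" "\<And>u. 0 \<le> u \<Longrightarrow> m \<le> f u"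
    using f_lower_bound by blast
  obtain T where T: "0 \<le> T" "\<And>t. T \<le> t \<Longrightarrow> measure N1 {t<..} + measure N2 {t<..} < M / 2"
    using tails_small[of "M / 2"] M_pos by auto
  have "m * (M / 2) \<le> rhs h t" if "T \<le> t" for t
  proof -
    have "m * (M / 2) \<le> m * (M - (measure N1 {T<..} + measure N2 {T<..}))"
      using T(2)[of T] m(1) by (intro mult_left_mono) auto
    also have "\<dots> \<le> rhs h t" using m T(1) that x_nonneg by (intro rhs_ge_window) auto
    finally show ?thesis .
  qed
  then have le: "m * (M / 2) * (t - T) \<le> x t" if "T \<le> t" for t
    using x_lower_increment[OF T(1) that, of "m * (M / 2)"] x_nonneg[of T] by force
  have "filterlim (\<lambda>t. m * (M / 2) * (- T + t)) at_top at_top"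
    using m(1) M_pos
    by (intro filterlim_tendsto_pos_mult_at_top[OF tendsto_const] filterlim_tendsto_add_at_top[OF tendsto_const] filterlim_ident) auto
  then show ?thesis
    by (rule filterlim_at_top_mono) (use le in \<open>auto simp: eventually_at_top_linorder intro!: exI[of _ T]\<close>)
qed

lemma x_eventually_ge: "\<exists>T\<ge>0. \<forall>t\<ge>T. X \<le> x t"
proof -
  have "\<forall>\<^sub>F t in at_top. X \<le> x t" using x_at_top by (auto simp: filterlim_at_top)
  then obtain T where "\<forall>t\<ge>T. X \<le> x t" by (auto simp: eventually_at_top_linorder)
  then show ?thesis by (intro exI[of _ "max T 0"]) auto
qed

text \<open>Values after time \<open>T\<close> are at most \<open>(1 + e / 2) * \<phi> (x t)\<close>
  because \<open>x\<close> and \<phi> increase; earlier ones are bounded by a constant and weighted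
  by a vanishing mass.\<close>

lemma rhs_upper:
  assumes e: "0 < e"
  shows "\<exists>T\<ge>0. \<forall>t\<ge>T. rhs h t \<le> (1 + e) * M * \<phi> (x t)"
proof -
  have phi0: "0 < \<phi> 0" using phi(1) by (auto simp: classS_def)
  obtain X where X: "X > 0" "\<And>u. X \<le> u \<Longrightarrow> f u \<le> (1 + e / 2) * \<phi> u"
    using asymp_classS_bounds[OF phi, of "e / 2"] e by auto
  obtain T where T: "0 \<le> T" "\<And>t. T \<le> t \<Longrightarrow> X \<le> x t" using x_eventually_ge by auto
  \<comment> \<open>The forcing is itself a history, hence bounded up to time
    \<open>T\<close>.\<close>
  have "history h" using history_forcing[OF hx] h_nonneg by (auto simp: history_def)
  then obtain C0 where C0: "\<And>v. v \<le> T \<Longrightarrow> h v \<le> C0" using picard_upper_bound by blast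
  define C where "C = max C0 0"
  have C: "0 \<le> C" "\<And>v. v \<le> T \<Longrightarrow> h v \<le> C" using C0 by (auto simp: C_def le_max_iff_disj)
  \<comment> \<open>With this tail mass the early values contribute at most
    \<open>e / 2 * M * \<phi> 0\<close>, which is absorbed since
    \<open>\<phi> 0 \<le> \<phi> (x t)\<close>.\<close>
  define d where "d = e / 2 * M * \<phi> 0 / (C + 1)"
  have d: "0 < d" using e M_pos phi0 C(1) by (auto simp: d_def)
  from tails_small[OF d]
  obtain T1 where T1: "0 \<le> T1 \<and> (\<forall>t\<ge>T1. measure N1 {t<..} + measure N2 {t<..} < d)"
    by (rule exE)
  have "rhs h t \<le> (1 + e) * M * \<phi> (x t)" if t: "T + T1 \<le> t" for t
  proof -
    define S where "S = (1 + e / 2) * \<phi> (x t)"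
    have phit: "\<phi> 0 \<le> \<phi> (x t)" using x_nonneg by (intro classS_mono[OF phi(1)]) auto
    then have S0: "0 \<le> S" using phi0 e by (simp add: S_def)
    have S: "h v \<le> S" if "v \<in> {T..t}" for v
    proof -
      have "h v \<le> (1 + e / 2) * \<phi> (x v)" using X(2) T(2) that by auto
      also have "\<dots> \<le> S" unfolding S_def using that T(1) e x_mono[of v t] x_nonneg
        by (intro mult_left_mono classS_mono[OF phi(1)]) auto
      finally show ?thesis .
    qed
    have "K1.conv \<tau> h t \<le> S * measure N1 UNIV + C * measure N1 {t - T<..}"
      using S C S0 by (intro K1.conv_le_split h_cont) auto
    moreover have "K2.conv 0 h t \<le> S * measure N2 UNIV + C * measure N2 {t - T<..}"
      using S C S0 by (intro K2.conv_le_split h_cont) auto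
    ultimately have "rhs h t \<le> S * M + C * (measure N1 {t - T<..} + measure N2 {t - T<..})"
      by (simp add: rhs_def M_eq[symmetric] algebra_simps)
    also have "\<dots> \<le> S * M + (C + 1) * d"
      using T1 t C(1) d by (intro add_left_mono mult_mono) (auto intro: less_imp_le)
    also have "(C + 1) * d = e / 2 * M * \<phi> 0"
      unfolding d_def times_divide_eq_right[of "C + 1"] using C(1) by (intro nonzero_mult_div_cancel_left) simp
    also have "e / 2 * M * \<phi> 0 \<le> e / 2 * M * \<phi> (x t)" using phit e M_pos by (intro mult_left_mono) auto
    finally show ?thesis by (simp add: S_def algebra_simps)
  qed
  then show ?thesis using T(1) T1 by (intro exI[of _ "T + T1"]) auto
qed

text \<open>Over a window of fixed length the solution grows by at most a multiple of \<open>\<phi> (x t)\<close>, so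
  \<open>\<phi> (x t)\<close> is asymptotically unaffected by bounded delays because \<open>deriv \<phi>\<close> tends to 0.\<close>

lemma phi_window:
  assumes e: "0 < e" and T: "0 \<le> T"
  shows "\<exists>T'\<ge>T. \<forall>t\<ge>T'. (1 - e) * \<phi> (x t) \<le> \<phi> (x (t - T))"
proof -
  obtain T1 where T1: "T1 \<ge> 0" "\<And>t. T1 \<le> t \<Longrightarrow> rhs h t \<le> (1 + 1) * M * \<phi> (x t)" using rhs_upper[of 1] by auto
  \<comment> \<open>The window growth is at most \<open>2 * M * T * \<phi> (x t)\<close>, so a slope
    below \<open>d\<close> changes \<phi> by at most \<open>e * \<phi> (x t)\<close>.\<close>
  define d where "d = e / (2 * M * T + 1)"
  have d: "0 < d" using e M_pos T by (simp add: d_def add_nonneg_pos)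
  obtain X where X: "X > 0" "\<And>u v. X \<le> u \<Longrightarrow> u \<le> v \<Longrightarrow> \<phi> v - \<phi> u \<le> d * (v - u)"
    using classS_slowly_growing[OF phi(1) d] by auto
  obtain T2 where T2: "T2 \<ge> 0" "\<And>t. T2 \<le> t \<Longrightarrow> X \<le> x t" using x_eventually_ge by auto
  have "(1 - e) * \<phi> (x t) \<le> \<phi> (x (t - T))" if t: "T + T1 + T2 \<le> t" for t
  proof -
    have p: "0 < \<phi> (x t)" using phi(1) x_nonneg by (auto simp: classS_def)
    have "x t - x (t - T) \<le> 2 * M * \<phi> (x t) * (t - (t - T))"
    proof (rule x_upper_increment)
      fix u assume u: "t - T \<le> u" "u \<le> t"
      have "rhs h u \<le> 2 * M * \<phi> (x u)" using T1(2)[of u] u t T2(1) by simp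
      also have "\<dots> \<le> 2 * M * \<phi> (x t)"
        using u t T1(1) T2(1) M_pos x_nonneg by (intro mult_left_mono classS_mono[OF phi(1)] x_mono) auto
      finally show "rhs h u \<le> 2 * M * \<phi> (x t)" .
    qed (use t T T1(1) T2(1) in auto)
    then have inc: "x t - x (t - T) \<le> 2 * M * T * \<phi> (x t)" by (simp add: algebra_simps)
    have "\<phi> (x t) - \<phi> (x (t - T)) \<le> d * (x t - x (t - T))"
      using t T T1(1) T2 by (intro X(2) x_mono) auto
    also have "\<dots> \<le> d * (2 * M * T * \<phi> (x t))" using inc d by (intro mult_left_mono) auto
    also have "\<dots> \<le> d * ((2 * M * T + 1) * \<phi> (x t))" using d p by (intro mult_left_mono mult_right_mono) auto
    also have "\<dots> = e * \<phi> (x t)" using M_pos T by (simp add: d_def add_nonneg_eq_0_iff)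
    finally show ?thesis by (simp add: algebra_simps)
  qed
  then show ?thesis using T T1(1) T2(1) by (intro exI[of _ "T + T1 + T2"]) auto
qed

lemma rhs_lower:
  assumes e: "0 < e" "e < 1"
  shows "\<exists>T\<ge>0. \<forall>t\<ge>T. (1 - e) * M * \<phi> (x t) \<le> rhs h t"
proof -
  \<comment> \<open>A factor \<open>1 - d\<close> is lost three times: comparing \<open>f\<close>
    with \<phi>, passing to the start of the window, and dropping the tail mass. The product is at
    least \<open>1 - 3 * d\<close>.\<close>
  define d where "d = e / 3"
  have d: "0 < d" "d < 1" using e by (auto simp: d_def)
  obtain T0 where T0: "0 \<le> T0" "measure N1 {T0<..} + measure N2 {T0<..} < d * M"
    using tails_small[of "d * M"] d M_pos by auto
  obtain X where X: "X > 0" "\<And>u. X \<le> u \<Longrightarrow> (1 - d) * \<phi> u \<le> f u"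
    using asymp_classS_bounds[OF phi d(1)] by auto
  obtain T1 where T1: "0 \<le> T1" "\<And>t. T1 \<le> t \<Longrightarrow> X \<le> x t" using x_eventually_ge by auto
  obtain T2 where T2: "T0 \<le> T2" "\<And>t. T2 \<le> t \<Longrightarrow> (1 - d) * \<phi> (x t) \<le> \<phi> (x (t - T0))"
    using phi_window[OF d(1) T0(1)] by auto
  have "(1 - e) * M * \<phi> (x t) \<le> rhs h t" if t: "T0 + T1 + T2 \<le> t" for t
  proof -
    have p: "0 < \<phi> (x t)" using phi(1) x_nonneg by (auto simp: classS_def)
    define S where "S = (1 - d) * ((1 - d) * \<phi> (x t))"
    have S0: "0 \<le> S" using p d by (simp add: S_def)
    have S: "S \<le> h v" if v: "t - T0 \<le> v" "v \<le> t" for v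
    proof -
      have "S \<le> (1 - d) * \<phi> (x (t - T0))" unfolding S_def using d T2(2)[of t] t T0 T1(1)
        by (intro mult_left_mono) auto
      also have "\<dots> \<le> (1 - d) * \<phi> (x v)" using d v t T1 T2(1) T0(1) x_nonneg
        by (intro mult_left_mono classS_mono[OF phi(1)] x_mono) auto
      also have "\<dots> \<le> h v" using X(2) T1(2)[of v] v t T2(1) T0(1) by auto
      finally show ?thesis .
    qed
    have "(1 - 3 * d) * (M * \<phi> (x t)) \<le> ((1 - d) * (1 - d) * (1 - d)) * (M * \<phi> (x t))"
    proof (intro mult_right_mono)
      have "(1 - d) * (1 - d) * (1 - d) - (1 - 3 * d) = d * d * (3 - d)" by (simp add: algebra_simps)
      moreover have "0 \<le> d * d * (3 - d)" using d by (intro mult_nonneg_nonneg) auto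
      ultimately show "1 - 3 * d \<le> (1 - d) * (1 - d) * (1 - d)" by linarith
    qed (use p M_pos in auto)
    also have "\<dots> = S * (M - d * M)" by (simp add: S_def algebra_simps)
    also have "\<dots> \<le> S * (M - (measure N1 {T0<..} + measure N2 {T0<..}))"
      using S0 T0(2) by (intro mult_left_mono) auto
    also have "\<dots> \<le> rhs h t" using S S0 t T0(1) T1(1) T2(1) by (intro rhs_ge_window) auto
    finally show ?thesis by (simp add: d_def algebra_simps)
  qed
  then show ?thesis using T0(1) T1(1) T2(1) by (intro exI[of _ "T0 + T1 + T2"]) auto
qed

lemma rhs_asymp: "((\<lambda>t. rhs h t / h t) \<longlongrightarrow> M) at_top"
proof -
  have p: "0 < \<phi> (x t)" for t using phi(1) x_nonneg by (auto simp: classS_def)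
  have 1: "((\<lambda>t. rhs h t / \<phi> (x t)) \<longlongrightarrow> M) at_top"
    unfolding tendsto_iff
  proof (intro allI impI)
    fix r :: real assume r: "0 < r"
    \<comment> \<open>The first bound gives \<open>e * M < r\<close>; the second keeps
      \<open>e < 1\<close> for the lower estimate.\<close>
    define e where "e = min (r / (2 * M)) (1 / 2)"
    have e: "0 < e" "e < 1" "e * M < r"
    proof -
      have "e * M \<le> r / (2 * M) * M" using M_pos by (intro mult_right_mono) (auto simp: e_def)
      then show "e * M < r" using M_pos r by simp
    qed (use r M_pos in \<open>auto simp: e_def\<close>)
    obtain T1 where T1: "\<And>t. T1 \<le> t \<Longrightarrow> rhs h t \<le> (1 + e) * M * \<phi> (x t)" using rhs_upper[OF e(1)] by auto
    obtain T2 where T2: "\<And>t. T2 \<le> t \<Longrightarrow> (1 - e) * M * \<phi> (x t) \<le> rhs h t" using rhs_lower[OF e(1,2)] by auto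
    show "\<forall>\<^sub>F t in at_top. dist (rhs h t / \<phi> (x t)) M < r"
      using eventually_ge_at_top[of "max T1 T2"]
    proof eventually_elim
      case (elim t)
      then have "rhs h t / \<phi> (x t) \<le> (1 + e) * M" "(1 - e) * M \<le> rhs h t / \<phi> (x t)"
        using T1[of t] T2[of t] p[of t] by (simp_all add: divide_le_eq le_divide_eq)
      then have "\<bar>rhs h t / \<phi> (x t) - M\<bar> \<le> e * M" by (auto simp: abs_le_iff algebra_simps)
      then show ?case using e(3) by (simp add: dist_real_def)
    qed
  qed
  have "((\<lambda>t. f (x t) / \<phi> (x t)) \<longlongrightarrow> 1) at_top"
    by (rule filterlim_compose[OF phi(2) x_at_top])
  from tendsto_divide[OF 1 this] have "((\<lambda>t. rhs h t / \<phi> (x t) / (f (x t) / \<phi> (x t))) \<longlongrightarrow> M) at_top" by simp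
  then show ?thesis
    using p f_pos by (simp add: less_imp_neq[OF p, symmetric])
qed

text \<open>By the chain rule \<open>G (x t)\<close> has derivative \<open>rhs h t / f (x t)\<close>
  almost everywhere, which tends to \<open>M\<close>. Since \<open>1 / f\<close> is bounded,
  \<open>G\<close> is Lipschitz and the composition stays locally Lipschitz.\<close>

lemma primitive_asymp:
  assumes G: "\<And>u. 0 < u \<Longrightarrow> (G has_real_derivative 1 / f u) (at u)"
  shows "((\<lambda>t. G (x t) / (M * t)) \<longlongrightarrow> 1) at_top"
proof -
  have x_pos: "0 < x t" for t
    using picard_ge_psi[OF hx, of t] psi_pos[of t] fixed by simp
  have "((\<lambda>t. G (x t) / t) \<longlongrightarrow> M) at_top"
  proof (rule tendsto_quotient_of_AE_deriv[OF _ _ rhs_asymp])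
    obtain m where m: "0 < m" "\<And>u. 0 \<le> u \<Longrightarrow> m \<le> f u"
      using f_lower_bound by blast
    have "(1 / m)-lipschitz_on {0<..} G"
    proof (rule bounded_derivative_imp_lipschitz)
      fix u :: real assume u: "u \<in> {0<..}"
      then have "0 < u" by simp
      from G[OF this] show "(G has_derivative (\<lambda>k. 1 / f u * k)) (at u within {0<..})"
        unfolding has_field_derivative_def by (rule has_derivative_at_withinI)
      show "onorm (\<lambda>k. 1 / f u * k) \<le> 1 / m"
        using u m(1) m(2)[of u] by (intro onorm_le) (auto simp: abs_mult divide_simps mult_mono)
    qed (use m in auto)
    then show "\<exists>L. L-lipschitz_on {0..b} (\<lambda>t. G (x t))" for b
    proof -
      assume L: "(1 / m)-lipschitz_on {0<..} G"
      obtain L' where "L'-lipschitz_on {0..b} x" using picard_lipschitz[OF hx, of b] fixed by auto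
      then have "(1 / m * L')-lipschitz_on {0..b} (\<lambda>t. G (x t))"
        by (rule lipschitz_on_compose2) (use x_pos in \<open>auto intro: lipschitz_on_subset[OF L]\<close>)
      then show ?thesis ..
    qed
    show "AE t in lborel. 0 < t \<longrightarrow> ((\<lambda>t. G (x t)) has_real_derivative rhs h t / f (x t)) (at t)"
      using AE_not_atoms
    proof eventually_elim
      case (elim t)
      show ?case
      proof
        assume "0 < t"
        then have "(x has_real_derivative rhs h t) (at t)" using picard_deriv[OF hx _ elim] fixed by simp
        from DERIV_chain2[OF G[OF x_pos] this]
        show "((\<lambda>t. G (x t)) has_real_derivative rhs h t / f (x t)) (at t)" by simp
      qed
    qed
  qed
  then have "((\<lambda>t. G (x t) / t / M) \<longlongrightarrow> M / M) at_top" using M_pos by (intro tendsto_intros) auto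
  then show ?thesis using M_pos by (simp add: mult.commute)
qed

end

section \<open>Reduction to finite Borel measures on the line\<close>

text \<open>The push-forward under inclusion: the given measures carry the trace sigma-algebra of
  the half-line, and this moves their restrictions to the Borel sets of the line.\<close>

definition restricted_kernel :: "real measure \<Rightarrow> real set \<Rightarrow> real measure" where
  "restricted_kernel \<mu> A = distr (restrict_space \<mu> A) borel (\<lambda>s. s)"

context
  fixes \<mu> :: "real measure" and A :: "real set"
  assumes borel: "sets \<mu> = sets (restrict_space borel {0..})"
    and A: "A \<in> sets borel" "A \<subseteq> {0..}"
begin

lemma space_half_line: "space \<mu> = {0..}"
  using sets_eq_imp_space_eq[OF borel] by (simp add: space_restrict_space)

lemma sets_half_line: "A \<in> sets \<mu>"
  using A unfolding borel sets_restrict_space by (intro image_eqI[of _ _ A]) auto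

lemma measurable_half_line:
  assumes "g \<in> borel_measurable borel"
  shows "g \<in> borel_measurable (restrict_space \<mu> A)"
proof -
  have "g \<in> borel_measurable (restrict_space borel {0..})" using assms by (rule measurable_restrict_space1)
  then have "g \<in> borel_measurable \<mu>" using measurable_cong_sets[OF borel refl, of borel] by blast
  then show ?thesis by (rule measurable_restrict_space1)
qed

lemma emeasure_restricted_kernel: "emeasure (restricted_kernel \<mu> A) UNIV = emeasure \<mu> A"
proof -
  have "emeasure (restricted_kernel \<mu> A) UNIV = emeasure (restrict_space \<mu> A) A"
    unfolding restricted_kernel_def using A(2)
    by (subst emeasure_distr) (auto simp: space_restrict_space space_half_line Int_absorb2 intro: measurable_half_line)
  also have "\<dots> = emeasure \<mu> A"
    using sets_half_line A(2) by (subst emeasure_restrict_space) (auto simp: space_half_line Int_absorb2)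
  finally show ?thesis .
qed

lemma causal_kernel_restricted:
  assumes "emeasure \<mu> A \<noteq> \<infinity>"
  shows "causal_kernel (restricted_kernel \<mu> A)"
proof (intro causal_kernel.intro causal_kernel_axioms.intro finite_measureI)
  show "sets (restricted_kernel \<mu> A) = sets borel" by (simp add: restricted_kernel_def)
  show "emeasure (restricted_kernel \<mu> A) (space (restricted_kernel \<mu> A)) \<noteq> \<infinity>"
    using assms emeasure_restricted_kernel by (simp add: restricted_kernel_def)
  show "AE s in restricted_kernel \<mu> A. 0 \<le> s"
    unfolding restricted_kernel_def using A(2) space_half_line
    by (subst AE_distr_iff) (auto intro: measurable_half_line simp: space_restrict_space)
qed

lemma integral_restricted_kernel:
  assumes "g \<in> borel_measurable borel"
  shows "(LINT s|restricted_kernel \<mu> A. g s) = (LINT s:A|\<mu>. (g s :: real))"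
proof -
  have "(LINT s|restricted_kernel \<mu> A. g s) = (LINT s|restrict_space \<mu> A. g s)"
    unfolding restricted_kernel_def using assms by (intro integral_distr measurable_half_line) auto
  also have "\<dots> = (LINT s:A|\<mu>. g s)"
    unfolding set_lebesgue_integral_def using sets_half_line A(2)
    by (intro integral_restrict_space) (auto simp: space_half_line Int_absorb2)
  finally show ?thesis .
qed

end

section \<open>The primitive and the passage to the stated hypotheses\<close>

lemma F_of_deriv:
  assumes f: "continuous_on {0..} f" "\<And>x. 0 \<le> x \<Longrightarrow> 0 < f x" and u: "0 < u"
  shows "(F_of f has_real_derivative 1 / f u) (at u)"
proof -
  \<comment> \<open>A compact interval in the positive axis containing the base point 1, with
    \<open>u\<close> in its interior.\<close>
  define a b where "a = min u 1 / 2" and "b = max u 1 + 1"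
  have ab: "0 < a" "a < u" "u < b" "a \<le> 1" "1 \<le> b" using u by (auto simp: a_def b_def)
  have "continuous_on {a..b} (\<lambda>x. 1 / f x)"
  proof (intro continuous_on_divide continuous_on_const ballI)
    show "continuous_on {a..b} f" using f(1) ab by (auto intro: continuous_on_subset)
    show "f x \<noteq> 0" if "x \<in> {a..b}" for x using f(2)[of x] that ab by auto
  qed
  then have "((\<lambda>x. LBINT y=1..x. 1 / f y) has_vector_derivative 1 / f u) (at u within {a..b})"
    using interval_integral_FTC2[of a 1 b "\<lambda>x. 1 / f x" u] ab by (simp add: one_ereal_def)
  then show ?thesis
    using ab at_within_interior[of u "{a..b}"]
    by (simp add: has_real_derivative_iff_has_vector_derivative F_of_def[abs_def] one_ereal_def)
qed

lemma F_of_1: "F_of f 1 = 0"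
  by (simp add: F_of_def)

lemma Limsup_ratio_bound:
  fixes g :: "real \<Rightarrow> real"
  assumes "Limsup at_top (\<lambda>x. ereal (g x)) < \<infinity>"
  shows "\<exists>L>0. \<forall>\<^sub>F x in at_top. g x \<le> L"
proof -
  obtain n :: nat where "Limsup at_top (\<lambda>x. ereal (g x)) < ereal (real n)"
    using assms by (auto simp: less_PInf_Ex_of_nat)
  then have "\<forall>\<^sub>F x in at_top. ereal (g x) < ereal (real n)" by (rule Limsup_lessD)
  then have "\<forall>\<^sub>F x in at_top. g x \<le> real n + 1" by eventually_elim simp
  then show ?thesis by (intro exI[of _ "real n + 1"]) auto
qed

lemma local_lipschitz_imp_lipschitz_Icc:
  assumes "local_lipschitz (UNIV :: real set) {0..} (\<lambda>_. f :: real \<Rightarrow> real)"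
  shows "\<exists>K. K-lipschitz_on {0..B} f"
proof -
  have "local_lipschitz {0 :: real} {0..B} (\<lambda>_. f)" using assms by (rule local_lipschitz_subset) auto
  then obtain K where "\<And>t. t \<in> {0 :: real} \<Longrightarrow> K-lipschitz_on {0..B} f"
    by (rule local_lipschitz_compact_implies_lipschitz) auto
  then show ?thesis by blast
qed

theorem theorem5:
  fixes \<tau> M :: real and \<mu>1 \<mu>2 :: "real measure" and f \<psi> :: "real \<Rightarrow> real"
  assumes tau: "0 < \<tau>"
    and borel1: "sets \<mu>1 = sets (restrict_space borel {0..})"
    and borel2: "sets \<mu>2 = sets (restrict_space borel {0..})"
    and M: "emeasure \<mu>1 {0..\<tau>} + emeasure \<mu>2 {0..} = ennreal M" "0 < M"
    and f: "continuous_on {0..} f" "\<And>x. 0 \<le> x \<Longrightarrow> 0 < f x"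
    and f_lipschitz: "local_lipschitz (UNIV :: real set) {0..} (\<lambda>_. f)"
    and f_asymp: "\<exists>\<phi>\<in>classS. ((\<lambda>x. f x / \<phi> x) \<longlongrightarrow> 1) at_top"
    and psi: "continuous_on {-\<tau>..0} \<psi>" "\<And>t. t \<in> {-\<tau>..0} \<Longrightarrow> 0 < \<psi> t"
    and limsup: "Limsup at_top (\<lambda>x. ereal (f x * F_of f x / x)) < \<infinity>"
  shows "\<exists>x. volterra_solution \<tau> \<mu>1 \<mu>2 f \<psi> x
    \<and> (\<forall>y. volterra_solution \<tau> \<mu>1 \<mu>2 f \<psi> y \<longrightarrow> (\<forall>t\<ge>-\<tau>. y t = x t))
    \<and> filterlim x at_top at_top
    \<and> ((\<lambda>t. F_of f (x t) / (M * t)) \<longlongrightarrow> 1) at_top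
    \<and> ((\<lambda>t. x t / F_inv f (M * t)) \<longlongrightarrow> 1) at_top"
proof -
  obtain \<phi> where phi: "\<phi> \<in> classS" "((\<lambda>x. f x / \<phi> x) \<longlongrightarrow> 1) at_top" using f_asymp by blast
  define N1 N2 where "N1 = restricted_kernel \<mu>1 {0..\<tau>}" and "N2 = restricted_kernel \<mu>2 {0..}"
  \<comment> \<open>\<open>f\<close> is given on the half-line and \<open>\<psi>\<close> on
    \<open>{-\<tau>..0}\<close>; clamping the argument extends both continuously and positively to
    the line.\<close>
  define g where "g u = f (max u 0)" for u
  define \<eta> where "\<eta> t = \<psi> (max (-\<tau>) (min t 0))" for t
  have g_eq: "g u = f u" if "0 \<le> u" for u using that by (simp add: g_def)
  have fin: "emeasure \<mu>1 {0..\<tau>} \<noteq> \<infinity>" "emeasure \<mu>2 {0..} \<noteq> \<infinity>"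
    using M(1) by (metis ennreal_neq_top ennreal_add_eq_top infinity_ennreal_def)+
  interpret K1: causal_kernel N1
    unfolding N1_def using borel1 fin by (intro causal_kernel_restricted) auto
  interpret K2: causal_kernel N2
    unfolding N2_def using borel2 fin by (intro causal_kernel_restricted) auto
  have "emeasure N1 UNIV + emeasure N2 UNIV = ennreal M"
    unfolding N1_def N2_def using borel1 borel2 M(1) by (simp add: emeasure_restricted_kernel)
  then have "ennreal (measure N1 UNIV + measure N2 UNIV) = ennreal M"
    by (simp add: K1.emeasure_eq_measure K2.emeasure_eq_measure)
  then have M_eq: "measure N1 UNIV + measure N2 UNIV = M"
    using M(2) by (simp add: ennreal_inj del: ennreal_plus)
  interpret delay_volterra N1 N2 \<tau> M g \<eta>
  proof
    show "continuous_on UNIV g"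
      unfolding g_def[abs_def] by (rule continuous_on_compose2[OF f(1)]) (auto intro!: continuous_intros)
    show "continuous_on UNIV \<eta>"
      unfolding \<eta>_def[abs_def] using tau by (intro continuous_on_compose2[OF psi(1)]) (auto intro!: continuous_intros)
    show "\<exists>K. K-lipschitz_on {0..B} g" for B
    proof -
      obtain K where "K-lipschitz_on {0..B} f" using local_lipschitz_imp_lipschitz_Icc[OF f_lipschitz] by blast
      then have "K-lipschitz_on {0..B} g" by (rule lipschitz_on_transform) (auto simp: g_eq)
      then show ?thesis ..
    qed
    show "\<exists>C. \<forall>x\<ge>0. g x \<le> C * (1 + x)"
      using asymp_classS_linear_growth[OF phi f(1)] by (simp add: g_eq)
  qed (use tau M(2) M_eq f(2) psi(2) in \<open>auto simp: g_def \<eta>_def\<close>)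
  \<comment> \<open>Two functions \<open>z\<close> and \<open>y\<close> appear so that the identity
    serves both the constructed solution and an arbitrary one, whose values left of
    \<open>-\<tau>\<close> are uncontrolled.\<close>
  have rhs_eq: "rhs (\<lambda>v. g (z v)) t =
      (LINT s:{0..\<tau>}|\<mu>1. f (y (t - s))) + (LINT s:{0..t}|\<mu>2. f (y (t - s)))"
    if z: "continuous_on UNIV z" and y: "\<And>v. -\<tau> \<le> v \<Longrightarrow> z v = y v \<and> 0 \<le> y v" and t: "0 < t" for z y t
  proof -
    have gz: "continuous_on UNIV (\<lambda>v. g (z v))" using forcing_cont[OF z] .
    have [measurable]: "(\<lambda>v. g (z v)) \<in> borel_measurable borel"
      using gz by (rule borel_measurable_continuous_onI)
    have gz_eq: "g (z v) = f (y v)" if "-\<tau> \<le> v" for v using y[OF that] by (simp add: g_eq)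
    have "K1.conv \<tau> (\<lambda>v. g (z v)) t = (LINT s:{0..\<tau>}|\<mu>1. indicator {..t + \<tau>} s * g (z (t - s)))"
      unfolding K1.conv_def unfolding N1_def using borel1 by (intro integral_restricted_kernel) auto
    \<comment> \<open>For \<open>s \<le> \<tau>\<close> and \<open>t > 0\<close> the cut-off
      \<open>s \<le> t + \<tau>\<close> holds automatically.\<close>
    also have "\<dots> = (LINT s:{0..\<tau>}|\<mu>1. f (y (t - s)))"
      using t by (intro set_lebesgue_integral_cong sets_half_line[OF borel1]) (auto simp: gz_eq)
    finally have 1: "K1.conv \<tau> (\<lambda>v. g (z v)) t = (LINT s:{0..\<tau>}|\<mu>1. f (y (t - s)))" .
    have "K2.conv 0 (\<lambda>v. g (z v)) t = (LINT s:{0..}|\<mu>2. indicator {..t + 0} s * g (z (t - s)))"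
      unfolding K2.conv_def unfolding N2_def using borel2 by (intro integral_restricted_kernel) auto
    \<comment> \<open>Here the cut-off is effective: it reduces the half-line to
      \<open>{0..t}\<close>.\<close>
    also have "\<dots> = (LINT s:{0..t}|\<mu>2. f (y (t - s)))"
      unfolding set_lebesgue_integral_def using tau
      by (intro Bochner_Integration.integral_cong) (auto simp: gz_eq indicator_def)
    finally show ?thesis using 1 by (simp add: rhs_def)
  qed
  obtain x where x: "history x" "picard x = x" using picard_fixed_point_exists by blast
  have x_pos: "0 \<le> x t" for t using x(1) by (simp add: history_def)
  have solution: "volterra_solution \<tau> \<mu>1 \<mu>2 f \<psi> x"
    unfolding volterra_solution_def
  proof (intro conjI allI impI ballI)
    show "continuous_on {-\<tau>..} x" using x(1) by (auto simp: history_def intro: continuous_on_subset)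
    show "abs_continuous_on_interval 0 b x" for b using fixed_point_abs_continuous[OF x(1)] x(2) by simp
    show "x t = \<psi> t" if "t \<in> {-\<tau>..0}" for t
      using picard_nonpos[of t x] that x(2) by (simp add: \<eta>_def)
    show "AE t in lborel. 0 < t \<longrightarrow> (x has_real_derivative
        (LINT s:{0..\<tau>}|\<mu>1. f (x (t - s))) + (LINT s:{0..t}|\<mu>2. f (x (t - s)))) (at t)"
      using AE_not_atoms
    proof eventually_elim
      case (elim t)
      show ?case
      proof
        assume t: "0 < t"
        have "rhs (\<lambda>v. g (x v)) t = (LINT s:{0..\<tau>}|\<mu>1. f (x (t - s))) + (LINT s:{0..t}|\<mu>2. f (x (t - s)))"
          using x(1) t by (intro rhs_eq) (auto simp: history_def)
        then show "(x has_real_derivative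
            (LINT s:{0..\<tau>}|\<mu>1. f (x (t - s))) + (LINT s:{0..t}|\<mu>2. f (x (t - s)))) (at t)"
          using picard_deriv[OF x(1) t elim] x(2) by simp
      qed
    qed
  qed (rule x_pos)
  have unique: "y t = x t" if y: "volterra_solution \<tau> \<mu>1 \<mu>2 f \<psi> y" and t: "-\<tau> \<le> t" for y t
  proof -
    \<comment> \<open>Freezing the values left of \<open>-\<tau>\<close> turns an arbitrary solution
      into a history.\<close>
    define z where "z t = y (max t (-\<tau>))" for t
    have y_cont: "continuous_on {-\<tau>..} y" and y_nonneg: "\<And>t. -\<tau> \<le> t \<Longrightarrow> 0 \<le> y t"
      and y_ac: "\<And>b. 0 < b \<Longrightarrow> abs_continuous_on_interval 0 b y"
      and y_psi: "\<And>t. t \<in> {-\<tau>..0} \<Longrightarrow> y t = \<psi> t"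
      and y_der: "AE t in lborel. 0 < t \<longrightarrow> (y has_real_derivative
          (LINT s:{0..\<tau>}|\<mu>1. f (y (t - s))) + (LINT s:{0..t}|\<mu>2. f (y (t - s)))) (at t)"
      using y unfolding volterra_solution_def by blast+
    have z_y: "z t = y t" if "-\<tau> \<le> t" for t using that by (simp add: z_def max_def)
    have z_cont: "continuous_on UNIV z"
      unfolding z_def[abs_def] by (rule continuous_on_compose2[OF y_cont]) (auto intro!: continuous_intros)
    have hz: "history z"
      using z_cont y_nonneg by (auto simp: history_def z_def max_def)
    have "picard z = z"
    proof (rule picard_eq_of_AE_deriv[OF hz])
      show "z t = \<eta> t" if "t \<le> 0" for t
        using y_psi[of "max t (-\<tau>)"] that tau by (simp add: z_def \<eta>_def max.commute)
      show "abs_continuous_on_interval 0 b z" if "0 < b" for b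
        using y_ac[OF that] by (rule abs_continuous_on_interval_cong[rotated]) (use z_y tau in auto)
      show "AE t in lborel. 0 < t \<longrightarrow> (z has_real_derivative rhs (\<lambda>v. g (z v)) t) (at t)"
        using y_der
      proof eventually_elim
        case (elim t)
        show ?case
        proof
          assume t: "0 < t"
          have "rhs (\<lambda>v. g (z v)) t = (LINT s:{0..\<tau>}|\<mu>1. f (y (t - s))) + (LINT s:{0..t}|\<mu>2. f (y (t - s)))"
            using z_cont z_y y_nonneg t by (intro rhs_eq) auto
          then have "(y has_real_derivative rhs (\<lambda>v. g (z v)) t) (at t)" using elim t by simp
          then show "(z has_real_derivative rhs (\<lambda>v. g (z v)) t) (at t)"
            by (rule has_field_derivative_transform_within_open[where S="{0<..}"])
              (use t tau z_y in auto)
        qed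
      qed
    qed
    then have "z = x" using picard_unique[OF hz x(1)] x(2) by blast
    then show ?thesis using z_y[OF t] by simp
  qed
  interpret delay_asymptotics N1 N2 \<tau> M g \<eta> \<phi> x
  proof
    have "\<forall>\<^sub>F u in at_top. f u / \<phi> u = g u / \<phi> u"
      using eventually_ge_at_top[of 0] by eventually_elim (simp add: g_eq)
    then show "((\<lambda>u. g u / \<phi> u) \<longlongrightarrow> 1) at_top" using phi(2) by (rule Lim_transform_eventually[rotated])
  qed (fact phi(1) x)+
  have F_lim: "((\<lambda>t. F_of f (x t) / (M * t)) \<longlongrightarrow> 1) at_top"
    using F_of_deriv[OF f] by (intro primitive_asymp) (simp add: g_eq)
  obtain L where L: "0 < L" "\<forall>\<^sub>F u in at_top. f u * F_of f u / u \<le> L"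
    using Limsup_ratio_bound[OF limsup] by blast
  have "((\<lambda>t. x t / F_inv f (M * t)) \<longlongrightarrow> 1) at_top"
    unfolding F_inv_def using f(2)
    by (intro inverse_asymptotics[OF _ F_of_deriv[OF f] F_of_1 L M(2) x_at_top F_lim]) auto
  then show ?thesis using solution unique x_at_top F_lim by blast
qed

end
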